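(* Let $\alpha,\beta\in\{1,2,3,4\}$ and $p=(p_1,\dots,p_4),\,q=(q_1,\dots,q_4)\in\mathbb{C}^4$. Let $\pi^3_{jk}:\mathbf{U}(2)\to\mathbb{C}$ ($1\le j,k\le 4$) be the entries of the matrix $$ \pi^3=\begin{bmatrix} z_{11}^3 & z_{11}^2z_{12} & z_{11}z_{12}^2 & z_{12}^3\\ 3z_{11}^2z_{21} & z_{11}(z_{11}z_{22}+2z_{12}z_{21}) & z_{12}(2z_{11}z_{22}+z_{12}z_{21}) & 3z_{12}^2z_{22}\\ 3z_{11}z_{21}^2 & z_{21}(2z_{11}z_{22}+z_{12}z_{21}) & z_{22}(z_{11}z_{22}+2z_{12}z_{21}) & 3z_{12}z_{22}^2\\ z_{21}^3 & z_{21}^2z_{22} & z_{21}z_{22}^2 & z_{22}^3 \end{bmatrix}, $$ where $z_{ij}$ are the matrix entries of $z\in\mathbf{U}(2)$, and define $P,Q:\mathbf{U}(2)\to\mathbb{C}$ by $$ P(z)=\sum_{j=1}^4 p_j\,\pi^3_{j\alpha}(z),\qquad Q(z)=\sum_{k=1}^4 q_k\,\pi^3_{k\beta}(z). $$ Let the rational function $f(z)=P(z)/Q(z)$ be defined on the open and dense subset $W_Q=\{z\in\mathbf{U}(2)\mid Q(z)\neq 0\}$ of $\mathbf{U}(2)$. If $\alpha\neq\beta$, then $f$ is proper biharmonic whenever $p_3q_4-p_4q_3\neq 0$ and $$ p_1q_4^3=q_3^2(3p_3q_4-2p_4q_3),\qquad q_1q_4^2=q_3^3, $$ $$ p_2q_4^2=q_3(2p_3q_4-p_4q_3),\qquad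 q_2q_4=q_3^2 . $$ The corresponding statement holds for the function induced on $\mathbf{SU}(2)$: under the same conditions, the restriction of $f$ to $W_Q\cap\mathbf{SU}(2)$ is proper biharmonic.
   Context: $\mathbf{U}(2)=\{z\in\mathbf{GL}_2(\mathbb{C})\mid zz^*=I_2\}$ and $\mathbf{SU}(2)=\{z\in\mathbf{U}(2)\mid\det z=1\}$ carry the left-invariant Riemannian metrics induced by the scalar product $g(Z,W)=\mathrm{Re}\,\mathrm{trace}(ZW^* )$ on their Lie algebras (as subalgebras of $\mathfrak{gl}_2(\mathbb{C})$). For a complex-valued smooth function $f$ on a Riemannian manifold, $\tau(f)=\mathrm{div}(\nabla f)$ is the (complex-linearly extended) Laplace–Beltrami operator, $\tau^0(f)=f$ and $\tau^r(f)=\tau(\tau^{r-1}(f))$. The function $f$ is called proper biharmonic if $\tau^2(f)=0$ and $\tau(f)$ does not vanish identically. The function $f=P/Q$ is invariant under the circle action $z\mapsto e^{i\theta}z$ on $\mathbf{U}(2)$ (it is a quotient of homogeneous polynomials of the same degree in the $z_{ij}$), and the function induced on $\mathbf{SU}(2)$ is its restriction to $W_Q\cap\mathbf{SU}(2)$. *)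

theory Defs
  imports "HOL-Analysis.Analysis"
begin

section \<open>The groups\<close>

type_synonym cmat2 = "complex^2^2"

definition conj_transpose :: "cmat2 \<Rightarrow> cmat2" where
  "conj_transpose A = (\<chi> i j. cnj (A $ j $ i))"

definition U2 :: "cmat2 set" where
  "U2 = {z. invertible z \<and> z ** conj_transpose z = mat 1}"

definition SU2 :: "cmat2 set" where
  "SU2 = {z \<in> U2. det z = 1}"

section \<open>Left-invariant Riemannian geometry of a matrix group\<close>

text \<open>
  Throughout, \<open>G\<close> is a Lie subgroup of \<open>GL(2, \<complex>)\<close>, such as \<open>U2\<close> or \<open>SU2\<close>. Its tangent space at
  \<open>z\<close> is \<open>z \<gg>\<close>, where \<open>\<gg>\<close> is the Lie algebra of \<open>G\<close>. A vector field \<open>V\<close> on (an open subset of)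
  \<open>G\<close> is represented by its left trivialization \<open>z \<mapsto> z\<inverse> V(z)\<close>, a map with values in \<open>\<gg>\<close>; the
  left-invariant fields are then the constant maps, and the left-invariant Riemannian metric is
  \<open>lie_metric\<close> at every point.
\<close>

definition lie_algebra :: "cmat2 set \<Rightarrow> cmat2 set" where
  "lie_algebra G = {X. \<exists>\<gamma> :: real \<Rightarrow> cmat2. (\<forall>t. \<gamma> t \<in> G) \<and> \<gamma> 0 = mat 1 \<and>
                          (\<gamma> has_vector_derivative X) (at 0)}"

definition lie_metric :: "cmat2 \<Rightarrow> cmat2 \<Rightarrow> real" where
  "lie_metric Z W = Re (trace (Z ** conj_transpose W))"

definition lie_bracket :: "cmat2 \<Rightarrow> cmat2 \<Rightarrow> cmat2" where
  "lie_bracket X Y = X ** Y - Y ** X"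

text \<open>
  The derivative of \<open>F\<close> at \<open>z\<close> along the left-invariant vector field \<open>X\<close>, whose value at \<open>z\<close> is
  \<open>z ** X\<close>. A Frechet derivative within \<open>G\<close> is only determined on tangent vectors of \<open>G\<close>,
  and it is only applied to such.
\<close>

definition lie_deriv ::
    "cmat2 set \<Rightarrow> cmat2 \<Rightarrow> (cmat2 \<Rightarrow> 'b::real_normed_vector) \<Rightarrow> cmat2 \<Rightarrow> 'b" where
  "lie_deriv G X F z = frechet_derivative F (at z within G) (z ** X)"

text \<open>
  \<open>f\<close> is smooth on the relatively open set \<open>W\<close>: all iterated derivatives along left-invariant
  vector fields (which form global frames) exist and are differentiable.
\<close>

definition smooth_on :: "cmat2 set \<Rightarrow> cmat2 set \<Rightarrow> (cmat2 \<Rightarrow> complex) \<Rightarrow> bool" where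
  "smooth_on G W f \<longleftrightarrow>
     (\<forall>Xs \<in> lists (lie_algebra G). \<forall>z \<in> W. foldr (lie_deriv G) Xs f differentiable (at z within G))"

definition gradient :: "cmat2 set \<Rightarrow> (cmat2 \<Rightarrow> real) \<Rightarrow> cmat2 \<Rightarrow> cmat2" where
  "gradient G f z =
     (THE Y. Y \<in> lie_algebra G \<and> (\<forall>X \<in> lie_algebra G. lie_metric Y X = lie_deriv G X f z))"

text \<open>
  The Levi-Civita connection on left-invariant fields, a bilinear map \<open>\<Gamma>\<close> on the Lie algebra
  that is torsion-free and metric (the functions \<open>g(Y, Z)\<close> being constant for left-invariant
  \<open>Y, Z\<close>). By the Koszul formula it is unique on the Lie algebra. The Leibniz rule then forces
  the extension \<open>covariant_deriv\<close> to arbitrary fields.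
\<close>

definition is_levi_civita :: "cmat2 set \<Rightarrow> (cmat2 \<Rightarrow> cmat2 \<Rightarrow> cmat2) \<Rightarrow> bool" where
  "is_levi_civita G \<Gamma> \<longleftrightarrow>
     (\<forall>X \<in> lie_algebra G. \<forall>Y \<in> lie_algebra G. \<forall>Z \<in> lie_algebra G. \<forall>a b.
        \<Gamma> X Y \<in> lie_algebra G \<and>
        \<Gamma> (a *\<^sub>R X + b *\<^sub>R Y) Z = a *\<^sub>R \<Gamma> X Z + b *\<^sub>R \<Gamma> Y Z \<and>
        \<Gamma> X (a *\<^sub>R Y + b *\<^sub>R Z) = a *\<^sub>R \<Gamma> X Y + b *\<^sub>R \<Gamma> X Z \<and>
        \<Gamma> X Y - \<Gamma> Y X = lie_bracket X Y \<and>
        lie_metric (\<Gamma> X Y) Z + lie_metric Y (\<Gamma> X Z) = 0)"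

definition levi_civita :: "cmat2 set \<Rightarrow> cmat2 \<Rightarrow> cmat2 \<Rightarrow> cmat2" where
  "levi_civita G = (SOME \<Gamma>. is_levi_civita G \<Gamma>)"

definition covariant_deriv :: "cmat2 set \<Rightarrow> cmat2 \<Rightarrow> (cmat2 \<Rightarrow> cmat2) \<Rightarrow> cmat2 \<Rightarrow> cmat2" where
  "covariant_deriv G X V z = lie_deriv G X V z + levi_civita G X (V z)"

definition orthonormal_basis :: "cmat2 set \<Rightarrow> cmat2 set \<Rightarrow> bool" where
  "orthonormal_basis G B \<longleftrightarrow> span B = lie_algebra G \<and>
     (\<forall>X \<in> B. \<forall>Y \<in> B. lie_metric X Y = (if X = Y then 1 else 0))"

text \<open>The trace of \<open>X \<mapsto> covariant_deriv G X V z\<close>, so independent of the chosen basis.\<close>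

definition divergence :: "cmat2 set \<Rightarrow> (cmat2 \<Rightarrow> cmat2) \<Rightarrow> cmat2 \<Rightarrow> real" where
  "divergence G V z =
     (\<Sum>X \<in> (SOME B. orthonormal_basis G B). lie_metric (covariant_deriv G X V z) X)"

definition laplace_beltrami :: "cmat2 set \<Rightarrow> (cmat2 \<Rightarrow> complex) \<Rightarrow> cmat2 \<Rightarrow> complex" where
  "laplace_beltrami G f z =
     Complex (divergence G (gradient G (\<lambda>w. Re (f w))) z)
             (divergence G (gradient G (\<lambda>w. Im (f w))) z)"

text \<open>
  The operators above are local, so for \<open>z\<close> in a relatively open \<open>W\<close> they compute the
  operators of the Riemannian manifold \<open>W\<close>; the values of \<open>f\<close> outside \<open>W\<close> are irrelevant.
\<close>

definition proper_biharmonic_on :: "cmat2 set \<Rightarrow> cmat2 set \<Rightarrow> (cmat2 \<Rightarrow> complex) \<Rightarrow> bool" where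
  "proper_biharmonic_on G W f \<longleftrightarrow>
     openin (top_of_set G) W \<and> smooth_on G W f \<and>
     (\<forall>z \<in> W. (laplace_beltrami G ^^ 2) f z = 0) \<and>
     (\<exists>z \<in> W. laplace_beltrami G f z \<noteq> 0)"

section \<open>The representation\<close>

definition pi3 :: "cmat2 \<Rightarrow> complex^4^4" where
  "pi3 z = (let z11 = z$1$1; z12 = z$1$2; z21 = z$2$1; z22 = z$2$2 in
     vector [
       vector [z11^3, z11^2 * z12, z11 * z12^2, z12^3],
       vector [3 * z11^2 * z21, z11 * (z11 * z22 + 2 * z12 * z21),
               z12 * (2 * z11 * z22 + z12 * z21), 3 * z12^2 * z22],
       vector [3 * z11 * z21^2, z21 * (2 * z11 * z22 + z12 * z21),
               z22 * (z11 * z22 + 2 * z12 * z21), 3 * z12 * z22^2],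
       vector [z21^3, z21^2 * z22, z21 * z22^2, z22^3]])"

end

theory Submission
  imports Defs
begin

text \<open>
  The hypotheses force \<open>q\<^sub>4 \<noteq> 0\<close>, and with \<open>t = q\<^sub>3 / q\<^sub>4\<close>, \<open>s = p\<^sub>3 - t p\<^sub>4 \<noteq> 0\<close> they say that
  \<open>q = q\<^sub>4 (t\<^sup>3, t\<^sup>2, t, 1)\<close> is a multiple of a point of the twisted cubic, while
  \<open>p = p\<^sub>4 (t\<^sup>3, t\<^sup>2, t, 1) + s (3t\<^sup>2, 2t, 1, 0)\<close> lies on the tangent line there. With
  \<open>u = t z\<^sub>1\<^sub>1 + z\<^sub>2\<^sub>1\<close> and \<open>v = t z\<^sub>1\<^sub>2 + z\<^sub>2\<^sub>2\<close> this makes \<open>Q\<close> a monomial in \<open>u, v\<close>, and \<open>P\<close> a monomial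
  plus a \<open>t\<close>-derivative of one. For \<open>\<alpha> > \<beta>\<close> and \<open>m = \<alpha> - \<beta>\<close> the quotient is
  \<open>f = A a\<^sup>m + B b a\<^sup>m + C a\<^sup>m\<^sup>-\<^sup>1 d\<close>, where \<open>a = v/u\<close>, \<open>b = z\<^sub>1\<^sub>1/u\<close>, \<open>d = det z / u\<^sup>2\<close> up to sign, and
  \<open>B = 3s/q\<^sub>4\<close>; for \<open>\<alpha> < \<beta>\<close> the two columns are exchanged. The functions \<open>a, b, d\<close> are harmonic, and the
  complex bilinear pairing \<open>\<kappa>\<close> of gradients satisfies \<open>\<kappa>(a, a) = \<kappa>(a, d) = 0\<close>, \<open>\<kappa>(a, b) = - d\<close>. Hence
  \<open>\<tau> f = - 2 m B a\<^sup>m\<^sup>-\<^sup>1 d\<close>, which is harmonic and not zero. All these functions are invariant under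
  \<open>z \<mapsto> e\<^sup>i\<^sup>\<theta> z\<close>, so only the traceless parts of the frame fields contribute and the computation
  is the same on both groups.
\<close>

section \<open>Adjoints for the real inner product on matrices, and derivatives of matrix
  curves\<close>

lemma lie_metric_eq_inner: "lie_metric Z W = Z \<bullet> W"
  by (simp add: lie_metric_def trace_def matrix_matrix_mult_def conj_transpose_def inner_vec_def
      inner_complex_def sum_2)

lemma conj_transpose_mult: "conj_transpose (X ** Y) = conj_transpose Y ** conj_transpose X"
  by (simp add: conj_transpose_def matrix_matrix_mult_def vec_eq_iff mult.commute)

lemma inner_mult_left_adjoint: "(X ** Y) \<bullet> Z = Y \<bullet> (conj_transpose X ** Z)" for X Y Z :: cmat2
  by (simp add: matrix_matrix_mult_def conj_transpose_def inner_vec_def inner_complex_def sum_2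
      algebra_simps)

lemma inner_mult_right_adjoint: "(Y ** X) \<bullet> Z = Y \<bullet> (Z ** conj_transpose X)" for X Y Z :: cmat2
  by (simp add: matrix_matrix_mult_def conj_transpose_def inner_vec_def inner_complex_def sum_2
      algebra_simps)

text \<open>Left and right multiplication by \<open>X\<close> have as adjoints the multiplications
  by \<open>conj_transpose X = - X\<close>. This is the infinitesimal form of the bi-invariance of
  the metric.\<close>

lemma lie_bracket_skew_adjoint:
  assumes "conj_transpose X = - X"
  shows "lie_bracket X Y \<bullet> Z + Y \<bullet> lie_bracket X Z = 0"
proof -
  have "- X ** Z = - (X ** Z)" "Z ** (- X) = - (Z ** X)"
    by (simp_all add: matrix_matrix_mult_def vec_eq_iff sum_negf)
  then show ?thesis
    by (simp add: lie_bracket_def inner_diff_left inner_diff_right inner_mult_left_adjoint[of X]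
        inner_mult_right_adjoint[of Y X] assms)
qed

lemma lie_bracket_self: "lie_bracket X X = 0"
  by (simp add: lie_bracket_def)

lemma lie_bracket_antisym: "lie_bracket Y X = - lie_bracket X Y"
  by (simp add: lie_bracket_def)

lemma linear_mult_left: "linear (\<lambda>M. z ** M)" for z :: cmat2
  by (rule linearI) (simp_all add: matrix_matrix_mult_def vec_eq_iff sum_2 scaleR_add_right
      distrib_left)

text \<open>Differentiability is tested by inner products with basis vectors, and such a vector
  \<open>axis k (axis l c)\<close> sees only the entry in row \<open>k\<close> and column
  \<open>l\<close>.\<close>

lemma has_vector_derivative_entries:
  fixes \<gamma> :: "real \<Rightarrow> complex^'n^'m"
  shows "(\<gamma> has_vector_derivative X) (at s within S) \<longleftrightarrow>
    (\<forall>i j. ((\<lambda>t. \<gamma> t $ i $ j) has_vector_derivative X $ i $ j) (at s within S))"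
proof
  assume "(\<gamma> has_vector_derivative X) (at s within S)"
  then show "\<forall>i j. ((\<lambda>t. \<gamma> t $ i $ j) has_vector_derivative X $ i $ j) (at s within S)"
    by (intro allI bounded_linear.has_vector_derivative[OF bounded_linear_vec_nth])
next
  assume e: "\<forall>i j. ((\<lambda>t. \<gamma> t $ i $ j) has_vector_derivative X $ i $ j) (at s within S)"
  have "((\<lambda>t. \<gamma> t \<bullet> b) has_derivative (\<lambda>t. (t *\<^sub>R X) \<bullet> b)) (at s within S)"
    if b_Basis: "b \<in> Basis" for b
  proof -
    obtain k l c where b: "b = axis k (axis l c)"
      using b_Basis unfolding Basis_vec_def by blast
    have "((\<lambda>t. \<gamma> t $ k $ l \<bullet> c) has_derivative (\<lambda>t. (t *\<^sub>R X $ k $ l) \<bullet> c)) (at s within S)"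
      using e by (intro has_derivative_inner_left) (simp add: has_vector_derivative_def)
    then show ?thesis
      by (simp add: b inner_axis)
  qed
  then show "(\<gamma> has_vector_derivative X) (at s within S)"
    unfolding has_vector_derivative_def by (subst has_derivative_componentwise_within) blast
qed

section \<open>The Lie algebras\<close>

lemma U2_iff: "z \<in> U2 \<longleftrightarrow> (\<forall>i j. (\<Sum>k\<in>UNIV. z $ i $ k * cnj (z $ j $ k)) =
    (if i = j then 1 else 0))"
proof -
  have "z ** conj_transpose z = mat 1 \<Longrightarrow> invertible z"
    by (metis invertible_def matrix_left_right_inverse)
  then show ?thesis
    by (auto simp: U2_def vec_eq_iff matrix_matrix_mult_def conj_transpose_def mat_def)
qed

lemma U2_iff_entries:
  "z \<in> U2 \<longleftrightarrow> z$1$1 * cnj (z$1$1) + z$1$2 * cnj (z$1$2) = 1 \<and>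
     z$2$1 * cnj (z$2$1) + z$2$2 * cnj (z$2$2) = 1 \<and>
     z$1$1 * cnj (z$2$1) + z$1$2 * cnj (z$2$2) = 0 \<and>
     z$2$1 * cnj (z$1$1) + z$2$2 * cnj (z$1$2) = 0"
  by (auto simp: U2_iff forall_2 sum_2)

lemma U2_mult: "z \<in> U2 \<Longrightarrow> w \<in> U2 \<Longrightarrow> z ** w \<in> U2"
proof -
  assume z: "z \<in> U2" and w: "w \<in> U2"
  have "(z ** w) ** (conj_transpose w ** conj_transpose z) = z ** (w ** conj_transpose w) ** conj_transpose z"
    by (simp add: matrix_mul_assoc)
  also have "\<dots> = mat 1"
    using z w by (simp add: U2_def)
  finally show ?thesis
    using z w by (simp add: U2_def invertible_mult conj_transpose_mult)
qed

lemma SU2_mult: "z \<in> SU2 \<Longrightarrow> w \<in> SU2 \<Longrightarrow> z ** w \<in> SU2"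
  by (simp add: SU2_def U2_mult det_mul)

lemma skew_hermitian_entries:
  "conj_transpose X = - X \<longleftrightarrow> (\<forall>i j. X $ i $ j + cnj (X $ j $ i) = 0)"
  by (auto simp: conj_transpose_def vec_eq_iff eq_neg_iff_add_eq_0 add.commute)

text \<open>The product of \<open>diag (cis (a * t), cis (b * t))\<close> and a rotation by
  \<open>r * t\<close> twisted by the phase \<open>w\<close>. It replaces the one-parameter group:
  only its velocity at 0 matters, and every skew-Hermitian matrix is such a velocity.\<close>

definition unitary_curve :: "real \<Rightarrow> real \<Rightarrow> real \<Rightarrow> complex \<Rightarrow> real \<Rightarrow> cmat2" where
  "unitary_curve a b r w t = vector
     [vector [cis (a * t) * cos (r * t), cis (a * t) * w * sin (r * t)],
      vector [- cis (b * t) * cnj w * sin (r * t), cis (b * t) * cos (r * t)]]"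

lemma unitary_curve_in_U2:
  assumes "cmod w = 1"
  shows "unitary_curve a b r w t \<in> U2"
proof -
  have w: "w * cnj w = 1"
    using assms by (simp add: complex_norm_square[symmetric])
  have c: "cis x * cnj (cis x) = 1" for x
    by (simp add: cis_cnj cis_mult)
  have sc: "complex_of_real (cos x) * cos x + complex_of_real (sin x) * sin x = 1" for x
    by (metis of_real_add of_real_mult of_real_1 power2_eq_square sin_cos_squared_add2)
  show ?thesis
    unfolding U2_iff_entries unitary_curve_def
    apply (simp del: cis_cnj)
    using w c[of "a*t"] c[of "b*t"] sc[of "r*t"]
    by (intro conjI; algebra)
qed

lemma det_unitary_curve:
  assumes "cmod w = 1"
  shows "det (unitary_curve a b r w t) = cis ((a + b) * t)"
proof -
  have w: "w * cnj w = 1"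
    using assms by (simp add: complex_norm_square[symmetric])
  have c: "cis ((a + b) * t) = cis (a * t) * cis (b * t)"
    by (simp add: cis_mult algebra_simps)
  have sc: "complex_of_real (cos (r*t)) * cos (r*t) + complex_of_real (sin (r*t)) * sin (r*t) = 1"
    by (metis of_real_add of_real_mult of_real_1 power2_eq_square sin_cos_squared_add2)
  show ?thesis
    unfolding det_2 unitary_curve_def c
    apply simp using w sc by algebra
qed

lemma unitary_curve_derivative:
  "(unitary_curve a b r w has_vector_derivative
     vector [vector [\<i> * a, r * w], vector [- (r * cnj w), \<i> * b]]) (at 0)"
proof -
  have c: "((\<lambda>t. cis (a * t)) has_vector_derivative \<i> * a) (at 0)" for a
  proof -
    have "((\<lambda>z. exp (\<i> * (a * z))) has_field_derivative \<i> * a) (at (complex_of_real 0))"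
      by (auto intro!: derivative_eq_intros)
    from has_vector_derivative_real_field[OF this, of UNIV] show ?thesis
      by (simp add: cis_conv_exp)
  qed
  have "((\<lambda>t. cos (r * t)) has_real_derivative 0) (at 0)"
    by (auto intro!: derivative_eq_intros)
  then have co: "((\<lambda>t. complex_of_real (cos (r * t))) has_vector_derivative 0) (at 0)"
    using has_vector_derivative_of_real[of "\<lambda>t. cos (r * t)" 0 "at 0"] by simp
  have "((\<lambda>t. sin (r * t)) has_real_derivative r) (at 0)"
    by (auto intro!: derivative_eq_intros)
  then have si: "((\<lambda>t. complex_of_real (sin (r * t))) has_vector_derivative r) (at 0)"
    by (rule has_vector_derivative_of_real)
  note product_rules = has_vector_derivative_mult[OF c co]
    has_vector_derivative_mult[OF has_vector_derivative_mult_left[OF c] si]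
    has_vector_derivative_minus[OF has_vector_derivative_mult[OF has_vector_derivative_mult_left[OF c] si]]
  show ?thesis
    unfolding has_vector_derivative_entries forall_2 unitary_curve_def
    using product_rules[of a] product_rules[of b] by (simp add: mult.commute)
qed

lemma unitary_curve_0: "unitary_curve a b r w 0 = mat 1"
  by (simp add: unitary_curve_def vec_eq_iff forall_2 mat_def)

lemma skew_hermitian_obtain:
  assumes "conj_transpose X = - X"
  obtains a b r w where "cmod w = 1"
    "X = vector [vector [\<i> * complex_of_real a, complex_of_real r * w],
      vector [- (complex_of_real r * cnj w), \<i> * complex_of_real b]]"
proof
  \<comment> \<open>Polar form of the off-diagonal entry, with modulus \<open>r\<close>. If the
    entry is 0, any phase will do, and the default 1 keeps \<open>cmod w = 1\<close>.\<close>
  let ?w = "if X$1$2 = 0 then 1 else sgn (X$1$2)"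
  show "cmod ?w = 1" by (simp add: norm_sgn)
  have w: "X$1$2 = cmod (X$1$2) * ?w"
    by (simp add: sgn_div_norm scaleR_conv_of_real)
  have e: "X $ i $ j + cnj (X $ j $ i) = 0" for i j
    using assms by (simp add: skew_hermitian_entries)
  have d: "X $ i $ i = \<i> * complex_of_real (Im (X $ i $ i))" for i
    using e[of i i] by (simp add: complex_eq_iff)
  have o: "X$2$1 = - (cmod (X$1$2) * cnj ?w)"
  proof -
    have "X$2$1 = - cnj (X$1$2)"
      using e[of 2 1] by (simp add: eq_neg_iff_add_eq_0)
    also have "cnj (X$1$2) = cmod (X$1$2) * cnj ?w"
      by (subst w) simp
    finally show ?thesis .
  qed
  show "X = vector [vector [\<i> * complex_of_real (Im (X$1$1)), complex_of_real (cmod (X$1$2)) * ?w],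
      vector [- (complex_of_real (cmod (X$1$2)) * cnj ?w), \<i> * complex_of_real (Im (X$2$2))]]"
    unfolding vec_eq_iff forall_2 vector_2 by (intro conjI d o w)
qed

text \<open>Differentiating the entries of
  \<open>\<gamma> ** conj_transpose \<gamma> = mat 1\<close> at 0 gives one inclusion;
  \<open>unitary_curve\<close> realises every skew-Hermitian velocity for the other.\<close>

lemma lie_algebra_U2: "lie_algebra U2 = {X. conj_transpose X = - X}"
proof (intro equalityI subsetI)
  fix X assume "X \<in> lie_algebra U2"
  then obtain \<gamma> where \<gamma>: "\<And>t. \<gamma> t \<in> U2" "\<gamma> 0 = mat 1" "(\<gamma> has_vector_derivative X) (at 0)"
    by (auto simp: lie_algebra_def)
  then have d: "((\<lambda>t. \<gamma> t $ i $ j) has_vector_derivative X $ i $ j) (at 0)" for i j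
    by (simp add: has_vector_derivative_entries)
  have "X $ i $ j + cnj (X $ j $ i) = 0" for i j
  proof -
    have "((\<lambda>t. \<Sum>k\<in>UNIV. \<gamma> t $ i $ k * cnj (\<gamma> t $ j $ k)) has_vector_derivative
        (\<Sum>k\<in>UNIV. \<gamma> 0 $ i $ k * cnj (X $ j $ k) + X $ i $ k * cnj (\<gamma> 0 $ j $ k))) (at 0)"
      by (intro has_vector_derivative_sum has_vector_derivative_mult has_vector_derivative_cnj d)
    moreover have "((\<lambda>t. \<Sum>k\<in>UNIV. \<gamma> t $ i $ k * cnj (\<gamma> t $ j $ k)) has_vector_derivative 0) (at 0)"
      using \<gamma>(1)[unfolded U2_iff, rule_format] by simp
    ultimately have "(\<Sum>k\<in>UNIV. \<gamma> 0 $ i $ k * cnj (X $ j $ k) + X $ i $ k * cnj (\<gamma> 0 $ j $ k)) = 0"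
      by (rule vector_derivative_unique_at)
    then show ?thesis
      using exhaust_2[of i] exhaust_2[of j] by (auto simp: \<gamma>(2) mat_def sum_2 add.commute)
  qed
  then show "X \<in> {X. conj_transpose X = - X}"
    by (simp add: skew_hermitian_entries)
next
  fix X assume "X \<in> {X. conj_transpose X = - X}"
  then have "conj_transpose X = - X"
    by simp
  then obtain a b r w where w: "cmod w = 1"
    and X: "X = vector [vector [\<i> * complex_of_real a, complex_of_real r * w],
      vector [- (complex_of_real r * cnj w), \<i> * complex_of_real b]]"
    by (rule skew_hermitian_obtain)
  show "X \<in> lie_algebra U2"
    unfolding lie_algebra_def X
    using unitary_curve_in_U2[OF w] unitary_curve_0 unitary_curve_derivative by blast
qed

text \<open>The derivative of the determinant at the identity is the trace. Conversely, trace 0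
  means \<open>a + b = 0\<close>, and then \<open>unitary_curve\<close> has determinant 1
  throughout.\<close>

lemma lie_algebra_SU2: "lie_algebra SU2 = {X. conj_transpose X = - X \<and> trace X = 0}"
proof (intro equalityI subsetI)
  fix X assume X: "X \<in> lie_algebra SU2"
  then obtain \<gamma> where \<gamma>: "\<And>t. \<gamma> t \<in> SU2" "\<gamma> 0 = mat 1" "(\<gamma> has_vector_derivative X) (at 0)"
    by (auto simp: lie_algebra_def)
  then have d: "((\<lambda>t. \<gamma> t $ i $ j) has_vector_derivative X $ i $ j) (at 0)" for i j
    by (simp add: has_vector_derivative_entries)
  have "((\<lambda>t. det (\<gamma> t)) has_vector_derivative
      ((\<gamma> 0 $ 1 $ 1 * X $ 2 $ 2 + X $ 1 $ 1 * \<gamma> 0 $ 2 $ 2) -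
       (\<gamma> 0 $ 1 $ 2 * X $ 2 $ 1 + X $ 1 $ 2 * \<gamma> 0 $ 2 $ 1))) (at 0)"
    unfolding det_2 by (intro has_vector_derivative_diff has_vector_derivative_mult d)
  moreover have "((\<lambda>t. det (\<gamma> t)) has_vector_derivative 0) (at 0)"
    using \<gamma>(1) by (simp add: SU2_def)
  ultimately have "(\<gamma> 0 $ 1 $ 1 * X $ 2 $ 2 + X $ 1 $ 1 * \<gamma> 0 $ 2 $ 2) -
       (\<gamma> 0 $ 1 $ 2 * X $ 2 $ 1 + X $ 1 $ 2 * \<gamma> 0 $ 2 $ 1) = 0"
    by (rule vector_derivative_unique_at)
  then have "trace X = 0"
    by (simp add: \<gamma>(2) mat_def trace_def sum_2 add.commute)
  moreover have "X \<in> lie_algebra U2"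
    using X by (auto simp: lie_algebra_def SU2_def)
  ultimately show "X \<in> {X. conj_transpose X = - X \<and> trace X = 0}"
    by (simp add: lie_algebra_U2)
next
  fix X assume X: "X \<in> {X. conj_transpose X = - X \<and> trace X = 0}"
  then have "conj_transpose X = - X"
    by simp
  then obtain a b r w where w: "cmod w = 1"
    and Xe: "X = vector [vector [\<i> * complex_of_real a, complex_of_real r * w],
      vector [- (complex_of_real r * cnj w), \<i> * complex_of_real b]]"
    by (rule skew_hermitian_obtain)
  have "a + b = 0"
    using X by (simp add: Xe trace_def sum_2 complex_eq_iff)
  then have "unitary_curve a b r w t \<in> SU2" for t
    using w by (simp add: SU2_def unitary_curve_in_U2 det_unitary_curve)
  then show "X \<in> lie_algebra SU2"
    unfolding lie_algebra_def Xe
    using unitary_curve_0 unitary_curve_derivative by blast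
qed

section \<open>What the two groups have in common\<close>

lemma conj_transpose_add: "conj_transpose (X + Y) = conj_transpose X + conj_transpose Y"
  and conj_transpose_diff: "conj_transpose (X - Y) = conj_transpose X - conj_transpose Y"
  and conj_transpose_scaleR: "conj_transpose (c *\<^sub>R X) = c *\<^sub>R conj_transpose X"
  by (simp_all add: conj_transpose_def vec_eq_iff)

lemma lie_bracket_skew_hermitian:
  assumes "conj_transpose X = - X" "conj_transpose Y = - Y"
  shows "conj_transpose (lie_bracket X Y) = - lie_bracket X Y"
proof -
  have "- Y ** - X = Y ** X" "- X ** - Y = X ** Y"
    by (simp_all add: matrix_matrix_mult_def vec_eq_iff)
  then show ?thesis
    by (simp add: lie_bracket_def conj_transpose_diff conj_transpose_mult assms)
qed

lemma trace_lie_bracket: "trace (lie_bracket X Y) = 0"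
  by (simp add: lie_bracket_def trace_sub trace_mul_sym[of X])

text \<open>The properties through which U(2) and SU(2) enter the argument, so that it is carried
  out once for both. The Lie algebra lies between su(2) and u(2).\<close>

locale unitary_matrix_group =
  fixes G :: "cmat2 set"
  assumes mult_closed: "z \<in> G \<Longrightarrow> w \<in> G \<Longrightarrow> z ** w \<in> G"
    and subspace_lie_algebra: "subspace (lie_algebra G)"
    and lie_bracket_closed: "X \<in> lie_algebra G \<Longrightarrow> Y \<in> lie_algebra G \<Longrightarrow> lie_bracket X Y \<in> lie_algebra G"
    and skew_hermitian: "X \<in> lie_algebra G \<Longrightarrow> conj_transpose X = - X"
    and traceless_in_lie_algebra: "conj_transpose X = - X \<Longrightarrow> trace X = 0 \<Longrightarrow> X \<in> lie_algebra G"

lemma subspace_skew_hermitian: "subspace {X. conj_transpose X = - X}"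
  by (simp add: subspace_def conj_transpose_add conj_transpose_scaleR)
    (simp add: conj_transpose_def vec_eq_iff)

lemma subspace_traceless: "subspace {X :: cmat2. trace X = 0}"
  by (simp add: subspace_def trace_def sum_2 flip: scaleR_add_right)
    (simp add: algebra_simps)

interpretation U2: unitary_matrix_group U2
proof
  show "subspace (lie_algebra U2)"
    unfolding lie_algebra_U2 by (rule subspace_skew_hermitian)
qed (simp_all only: U2_mult lie_algebra_U2 lie_bracket_skew_hermitian mem_Collect_eq)

interpretation SU2: unitary_matrix_group SU2
proof
  show "subspace (lie_algebra SU2)"
    using subspace_inter[OF subspace_skew_hermitian subspace_traceless]
    by (simp add: lie_algebra_SU2 Int_def)
qed (simp_all only: SU2_mult lie_algebra_SU2 lie_bracket_skew_hermitian trace_lie_bracket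
    mem_Collect_eq simp_thms)

section \<open>Locality\<close>

text \<open>Derivatives at \<open>z\<close> within \<open>G\<close> see only the values near
  \<open>z\<close>. Closed formulas for \<open>f\<close> and its derivatives hold only where a
  denominator does not vanish; this and the lemmas built on it allow them to be substituted under
  all operators.\<close>

lemma has_derivative_cong_openin:
  assumes "openin (top_of_set G) V" "z \<in> V" "\<And>w. w \<in> V \<Longrightarrow> f w = g w"
  shows "(f has_derivative D) (at z within G) \<longleftrightarrow> (g has_derivative D) (at z within G)"
proof -
  obtain d where d: "d > 0" "\<And>w. w \<in> G \<Longrightarrow> dist w z < d \<Longrightarrow> w \<in> V" and "z \<in> G"
    using assms(1,2) unfolding openin_euclidean_subtopology_iff by blast
  then show ?thesis
    using assms(3) by (metis has_derivative_transform_within)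
qed

lemma lie_deriv_cong:
  assumes "openin (top_of_set G) V" "z \<in> V" "\<And>w. w \<in> V \<Longrightarrow> f w = g w"
  shows "lie_deriv G X f z = lie_deriv G X g z"
  by (simp add: lie_deriv_def frechet_derivative_def has_derivative_cong_openin[OF assms])

lemma differentiable_cong_openin:
  assumes "openin (top_of_set G) V" "z \<in> V" "\<And>w. w \<in> V \<Longrightarrow> f w = g w"
  shows "f differentiable (at z within G) \<longleftrightarrow> g differentiable (at z within G)"
  by (simp add: differentiable_def has_derivative_cong_openin[OF assms])

lemma foldr_lie_deriv_cong:
  assumes V: "openin (top_of_set G) V" and fg: "\<And>w. w \<in> V \<Longrightarrow> f w = g w" and "z \<in> V"
  shows "foldr (lie_deriv G) Xs f z = foldr (lie_deriv G) Xs g z"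
  using \<open>z \<in> V\<close>
proof (induction Xs arbitrary: z)
  case Nil
  then show ?case
    by (simp add: fg)
next
  case (Cons X Xs)
  then show ?case
    using lie_deriv_cong[OF V, of z "foldr (lie_deriv G) Xs f" "foldr (lie_deriv G) Xs g" X]
    by simp
qed

lemma smooth_on_cong:
  assumes V: "openin (top_of_set G) V" and fg: "\<And>w. w \<in> V \<Longrightarrow> f w = g w"
    and g: "smooth_on G V g"
  shows "smooth_on G V f"
  unfolding smooth_on_def
proof (intro ballI)
  fix Xs z assume "Xs \<in> lists (lie_algebra G)" "z \<in> V"
  then have "foldr (lie_deriv G) Xs g differentiable at z within G"
    using g unfolding smooth_on_def by blast
  then show "foldr (lie_deriv G) Xs f differentiable at z within G"
    by (subst differentiable_cong_openin[OF V \<open>z \<in> V\<close>]) (rule foldr_lie_deriv_cong[OF V fg])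
qed

lemma divergence_gradient_cong:
  assumes V: "openin (top_of_set G) V" and "z \<in> V" and fg: "\<And>w. w \<in> V \<Longrightarrow> f w = g w"
  shows "divergence G (gradient G f) z = divergence G (gradient G g) z"
proof -
  \<comment> \<open>Agreement of the gradients is needed on all of \<open>V\<close>, since the
    divergence differentiates them again.\<close>
  have gr: "gradient G f w = gradient G g w" if "w \<in> V" for w
    using lie_deriv_cong[OF V that fg] by (simp add: gradient_def)
  show ?thesis
    using gr[OF \<open>z \<in> V\<close>] lie_deriv_cong[OF V \<open>z \<in> V\<close> gr]
    by (simp add: divergence_def covariant_deriv_def)
qed

lemma laplace_beltrami_cong:
  assumes V: "openin (top_of_set G) V" and "z \<in> V" and fg: "\<And>w. w \<in> V \<Longrightarrow> f w = g w"
  shows "laplace_beltrami G f z = laplace_beltrami G g z"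
  unfolding laplace_beltrami_def
  by (intro arg_cong2[where f = Complex] divergence_gradient_cong[OF V \<open>z \<in> V\<close>]) (simp_all add: fg)

context unitary_matrix_group
begin

section \<open>The Laplacian in an orthonormal frame\<close>

text \<open>As \<open>G\<close> is not open in the matrix space, a derivative within
  \<open>G\<close> is not unique and \<open>frechet_derivative\<close> is a mere choice. On the
  tangent vector \<open>z ** X\<close>, however, any derivative gives the velocity of
  \<open>F\<close> along the curve \<open>z ** \<gamma> t\<close> in \<open>G\<close>, so all of
  them agree there.\<close>

lemma lie_deriv_eq:
  fixes F :: "cmat2 \<Rightarrow> 'b::real_normed_vector"
  assumes "z \<in> G" "X \<in> lie_algebra G" and D: "(F has_derivative D) (at z within G)"
  shows "lie_deriv G X F z = D (z ** X)"
proof -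
  obtain \<gamma> where \<gamma>: "\<And>t. \<gamma> t \<in> G" "\<gamma> 0 = mat 1" "(\<gamma> has_vector_derivative X) (at 0)"
    using \<open>X \<in> lie_algebra G\<close> by (auto simp: lie_algebra_def)
  have c: "((\<lambda>t. z ** \<gamma> t) has_vector_derivative z ** X) (at 0)"
    by (rule bounded_linear.has_vector_derivative[OF _ \<gamma>(3)])
      (simp add: linear_mult_left linear_linear)
  have chain: "((F \<circ> (\<lambda>t. z ** \<gamma> t)) has_vector_derivative D' (z ** X)) (at 0)"
    if "(F has_derivative D') (at z within G)" for D'
  proof (rule vector_derivative_diff_chain_within[OF c])
    show "(F has_derivative D') (at (z ** \<gamma> 0) within range (\<lambda>t. z ** \<gamma> t))"
      using that \<open>z \<in> G\<close> mult_closed \<gamma>(1)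
      by (auto simp: \<gamma>(2) intro: has_derivative_subset)
  qed
  have "(F has_derivative frechet_derivative F (at z within G)) (at z within G)"
    using D differentiableI frechet_derivative_works by blast
  from vector_derivative_unique_at[OF chain[OF this] chain[OF D]] show ?thesis
    by (simp add: lie_deriv_def)
qed

lemma lie_deriv_bounded_linear:
  assumes "z \<in> G" "X \<in> lie_algebra G" "F differentiable (at z within G)" "bounded_linear h"
  shows "lie_deriv G X (\<lambda>w. h (F w)) z = h (lie_deriv G X F z)"
proof -
  have D: "(F has_derivative frechet_derivative F (at z within G)) (at z within G)"
    using assms(3) frechet_derivative_works by blast
  show ?thesis
    using lie_deriv_eq[OF assms(1,2) bounded_linear.has_derivative[OF assms(4) D]]
      lie_deriv_eq[OF assms(1,2) D] by simp
qed

text \<open>The very choice made in \<open>divergence\<close>, so that its sum is a sum over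
  \<open>frame\<close>.\<close>

definition frame :: "cmat2 set" where
  "frame = (SOME B. orthonormal_basis G B)"

lemma orthonormal_basis_frame: "orthonormal_basis G frame"
proof -
  obtain B where B: "pairwise orthogonal B" "\<And>X. X \<in> B \<Longrightarrow> norm X = 1" "span B = lie_algebra G"
    using orthonormal_basis_subspace[OF subspace_lie_algebra] by metis
  then have "orthonormal_basis G B"
    by (auto simp: orthonormal_basis_def lie_metric_eq_inner norm_eq_1 pairwise_def orthogonal_def)
  then show ?thesis
    unfolding frame_def by (rule someI)
qed

lemma span_frame: "span frame = lie_algebra G"
  and inner_frame: "E \<in> frame \<Longrightarrow> E' \<in> frame \<Longrightarrow> E \<bullet> E' = (if E = E' then 1 else 0)"
  using orthonormal_basis_frame by (simp_all add: orthonormal_basis_def lie_metric_eq_inner)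

lemma frame_in_lie_algebra: "E \<in> frame \<Longrightarrow> E \<in> lie_algebra G"
  using span_base span_frame by blast

lemma pairwise_orthogonal_frame: "pairwise orthogonal frame"
  by (simp add: pairwise_def orthogonal_def inner_frame)

lemma finite_frame: "finite frame"
proof -
  have "0 \<notin> frame"
    using inner_frame by fastforce
  then show ?thesis
    using pairwise_orthogonal_independent[OF pairwise_orthogonal_frame] independent_imp_finite
    by blast
qed

lemma frame_expand:
  assumes "X \<in> lie_algebra G"
  shows "(\<Sum>E\<in>frame. (X \<bullet> E) *\<^sub>R E) = X"
  using assms
  by (intro orthonormal_basis_expand pairwise_orthogonal_frame finite_frame)
    (simp_all add: norm_eq_1 inner_frame span_frame)

lemma frame_parseval:
  assumes "X \<in> lie_algebra G"
  shows "(\<Sum>E\<in>frame. (X \<bullet> E) * (Y \<bullet> E)) = X \<bullet> Y"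
proof -
  have "X \<bullet> Y = (\<Sum>E\<in>frame. (X \<bullet> E) *\<^sub>R E) \<bullet> Y"
    by (simp add: frame_expand[OF assms])
  then show ?thesis
    by (simp add: inner_sum_left inner_commute[of Y])
qed

text \<open>For a bi-invariant metric, half the bracket is a Levi-Civita connection. It serves only
  as a witness that one exists; later steps use the axioms of the chosen one.\<close>

lemma levi_civita: "is_levi_civita G (levi_civita G)"
proof -
  have scale: "lie_bracket (a *\<^sub>R X + b *\<^sub>R Y) Z = a *\<^sub>R lie_bracket X Z + b *\<^sub>R lie_bracket Y Z"
    and scale': "lie_bracket Z (a *\<^sub>R X + b *\<^sub>R Y) = a *\<^sub>R lie_bracket Z X + b *\<^sub>R lie_bracket Z Y" for a b X Y Z
    by (simp_all add: lie_bracket_def matrix_matrix_mult_def vec_eq_iff sum_2 algebra_simps)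
  have "is_levi_civita G (\<lambda>X Y. (1/2) *\<^sub>R lie_bracket X Y)"
    unfolding is_levi_civita_def
  proof (intro ballI allI conjI)
    fix X Y Z and a b :: real
    assume XYZ: "X \<in> lie_algebra G" "Y \<in> lie_algebra G" "Z \<in> lie_algebra G"
    show "(1/2) *\<^sub>R lie_bracket X Y \<in> lie_algebra G"
      using XYZ subspace_lie_algebra lie_bracket_closed by (simp add: subspace_scale)
    show "(1/2) *\<^sub>R lie_bracket (a *\<^sub>R X + b *\<^sub>R Y) Z =
        a *\<^sub>R (1/2) *\<^sub>R lie_bracket X Z + b *\<^sub>R (1/2) *\<^sub>R lie_bracket Y Z"
      by (simp add: scale scaleR_add_right)
    show "(1/2) *\<^sub>R lie_bracket X (a *\<^sub>R Y + b *\<^sub>R Z) =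
        a *\<^sub>R (1/2) *\<^sub>R lie_bracket X Y + b *\<^sub>R (1/2) *\<^sub>R lie_bracket X Z"
      by (simp add: scale' scaleR_add_right)
    show "(1/2) *\<^sub>R lie_bracket X Y - (1/2) *\<^sub>R lie_bracket Y X = lie_bracket X Y"
      by (simp add: lie_bracket_antisym[of Y X] flip: scaleR_add_left)
    show "lie_metric ((1/2) *\<^sub>R lie_bracket X Y) Z + lie_metric Y ((1/2) *\<^sub>R lie_bracket X Z) = 0"
      using lie_bracket_skew_adjoint[OF skew_hermitian[OF XYZ(1)], of Y Z]
      by (simp add: lie_metric_eq_inner)
  qed
  then show ?thesis
    unfolding levi_civita_def by (rule someI[of "is_levi_civita G"])
qed

text \<open>
  The Christoffel term is \<open>g([X, Y], X)\<close>, which vanishes because the metric is bi-invariant.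
  Hence the connection does not contribute to the divergence.
\<close>

lemma levi_civita_inner_self:
  assumes "X \<in> lie_algebra G" "Y \<in> lie_algebra G"
  shows "levi_civita G X Y \<bullet> X = 0"
proof -
  let ?\<Gamma> = "levi_civita G"
  have "?\<Gamma> X Y - ?\<Gamma> Y X = lie_bracket X Y" "?\<Gamma> Y X \<bullet> X + X \<bullet> ?\<Gamma> Y X = 0"
    using levi_civita assms unfolding is_levi_civita_def lie_metric_eq_inner by blast+
  then have "?\<Gamma> X Y = ?\<Gamma> Y X + lie_bracket X Y" "?\<Gamma> Y X \<bullet> X = 0"
    by (simp_all add: diff_eq_eq add.commute inner_commute[of X])
  moreover have "lie_bracket X Y \<bullet> X = 0"
    using lie_bracket_skew_adjoint[OF skew_hermitian[OF assms(1)], of Y X]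
    by (simp add: lie_bracket_self)
  ultimately show ?thesis
    by (simp add: inner_add_left)
qed

text \<open>Expanding \<open>X\<close> in the frame shows that the sum represents the differential.
  Another representing \<open>Y\<close> differs from it by an element of the Lie algebra orthogonal
  to the whole Lie algebra, hence to itself.\<close>

lemma gradient_eq:
  assumes "F differentiable (at z within G)"
  shows "gradient G F z = (\<Sum>E\<in>frame. lie_deriv G E F z *\<^sub>R E)"
  unfolding gradient_def
proof (rule the_equality)
  let ?D = "frechet_derivative F (at z within G)"
  let ?V = "\<Sum>E\<in>frame. lie_deriv G E F z *\<^sub>R E"
  have "linear ?D"
    using assms linear_frechet_derivative by blast
  then have lin: "linear (\<lambda>X. ?D (z ** X))"
    using linear_compose[OF linear_mult_left] by (simp add: o_def)
  have mem: "?V \<in> lie_algebra G"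
    by (intro subspace_sum subspace_scale subspace_lie_algebra frame_in_lie_algebra)
  have V: "?V \<bullet> X = lie_deriv G X F z" if "X \<in> lie_algebra G" for X
  proof -
    have "lie_deriv G X F z = ?D (z ** (\<Sum>E\<in>frame. (X \<bullet> E) *\<^sub>R E))"
      by (simp add: lie_deriv_def frame_expand[OF that])
    also have "\<dots> = (\<Sum>E\<in>frame. (X \<bullet> E) * ?D (z ** E))"
      using linear_sum[OF lin, of "\<lambda>E. (X \<bullet> E) *\<^sub>R E" frame] linear_scale[OF lin] by simp
    finally show ?thesis
      by (simp add: inner_sum_left lie_deriv_def inner_commute[of X] mult.commute)
  qed
  show "?V \<in> lie_algebra G \<and> (\<forall>X\<in>lie_algebra G. lie_metric ?V X = lie_deriv G X F z)"
    using mem V by (simp add: lie_metric_eq_inner)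
  fix Y assume Y: "Y \<in> lie_algebra G \<and> (\<forall>X\<in>lie_algebra G. lie_metric Y X = lie_deriv G X F z)"
  have "Y - ?V \<in> lie_algebra G"
    using Y mem subspace_diff[OF subspace_lie_algebra] by blast
  then have "(Y - ?V) \<bullet> (Y - ?V) = 0"
    using Y V by (simp add: lie_metric_eq_inner inner_diff_left)
  then show "Y = ?V"
    by simp
qed

text \<open>A real-linear \<open>h\<close> covers \<open>Re\<close> and \<open>Im\<close> at once,
  as it commutes with differentiation. The connection term is orthogonal to \<open>X\<close>, so
  only second derivatives along the frame remain.\<close>

lemma divergence_gradient_eq:
  fixes f :: "cmat2 \<Rightarrow> complex" and h :: "complex \<Rightarrow> real"
  assumes V: "openin (top_of_set G) V" and "z \<in> V" and f: "smooth_on G V f"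
    and h: "bounded_linear h"
  shows "divergence G (gradient G (\<lambda>w. h (f w))) z =
    h (\<Sum>E\<in>frame. lie_deriv G E (lie_deriv G E f) z)"
proof -
  have VG: "V \<subseteq> G"
    using V openin_imp_subset by blast
  have d0: "f differentiable (at w within G)" if "w \<in> V" for w
    using f that unfolding smooth_on_def by (metis foldr.simps(1) id_apply lists.Nil)
  have d1: "lie_deriv G E f differentiable (at w within G)" if "w \<in> V" "E \<in> frame" for w E
  proof -
    have "[E] \<in> lists (lie_algebra G)"
      using frame_in_lie_algebra[OF \<open>E \<in> frame\<close>] by simp
    then have "foldr (lie_deriv G) [E] f differentiable (at w within G)"
      using f \<open>w \<in> V\<close> unfolding smooth_on_def by blast
    then show ?thesis
      by simp
  qed
  have grad: "gradient G (\<lambda>w. h (f w)) w = (\<Sum>E\<in>frame. h (lie_deriv G E f w) *\<^sub>R E)" if "w \<in> V" for w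
  proof -
    have "(\<lambda>w. h (f w)) differentiable (at w within G)"
      using d0[OF that] bounded_linear.has_derivative[OF h] unfolding differentiable_def by blast
    then have "gradient G (\<lambda>w. h (f w)) w = (\<Sum>E\<in>frame. lie_deriv G E (\<lambda>w. h (f w)) w *\<^sub>R E)"
      by (rule gradient_eq)
    also have "\<dots> = (\<Sum>E\<in>frame. h (lie_deriv G E f w) *\<^sub>R E)"
      using that VG d0[OF that] h frame_in_lie_algebra
      by (intro sum.cong refl arg_cong2[where f = scaleR] lie_deriv_bounded_linear) auto
    finally show ?thesis .
  qed
  let ?V = "gradient G (\<lambda>w. h (f w))"
  have "lie_metric (covariant_deriv G X ?V z) X = h (lie_deriv G X (lie_deriv G X f) z)"
    if X: "X \<in> frame" for X
  proof -
    let ?D = "\<lambda>E. frechet_derivative (lie_deriv G E f) (at z within G)"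
    have D: "(lie_deriv G E f has_derivative ?D E) (at z within G)" if "E \<in> frame" for E
      using d1[OF \<open>z \<in> V\<close> that] frechet_derivative_works by blast
    have "lie_deriv G X ?V z = lie_deriv G X (\<lambda>w. \<Sum>E\<in>frame. h (lie_deriv G E f w) *\<^sub>R E) z"
      by (rule lie_deriv_cong[OF V \<open>z \<in> V\<close> grad])
    also have "\<dots> = (\<Sum>E\<in>frame. h (?D E (z ** X)) *\<^sub>R E)"
    proof (rule lie_deriv_eq)
      show "((\<lambda>w. \<Sum>E\<in>frame. h (lie_deriv G E f w) *\<^sub>R E) has_derivative
          (\<lambda>Y. \<Sum>E\<in>frame. h (?D E Y) *\<^sub>R E)) (at z within G)"
        by (intro has_derivative_sum has_derivative_scaleR_left bounded_linear.has_derivative[OF h] D)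
    qed (use \<open>z \<in> V\<close> VG frame_in_lie_algebra[OF X] in auto)
    finally have "lie_deriv G X ?V z \<bullet> X = (\<Sum>E\<in>frame. h (?D E (z ** X)) * (E \<bullet> X))"
      by (simp add: inner_sum_left)
    \<comment> \<open>By orthonormality only the summand \<open>E = X\<close> survives.\<close>
    also have "\<dots> = (\<Sum>E\<in>frame. if E = X then h (?D X (z ** X)) else 0)"
      using X by (intro sum.cong) (auto simp: inner_frame)
    also have "\<dots> = h (lie_deriv G X (lie_deriv G X f) z)"
      using X by (simp add: finite_frame lie_deriv_def)
    finally have 1: "lie_deriv G X ?V z \<bullet> X = h (lie_deriv G X (lie_deriv G X f) z)" .
    have "?V z \<in> lie_algebra G"
      unfolding grad[OF \<open>z \<in> V\<close>]
      by (intro subspace_sum subspace_scale subspace_lie_algebra frame_in_lie_algebra)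
    then have "levi_civita G X (?V z) \<bullet> X = 0"
      using frame_in_lie_algebra[OF X] by (intro levi_civita_inner_self)
    then show ?thesis
      by (simp add: covariant_deriv_def lie_metric_eq_inner inner_add_left 1)
  qed
  then show ?thesis
    using h by (simp add: divergence_def flip: frame_def)
      (simp add: linear_sum[OF bounded_linear.linear])
qed

lemma laplace_beltrami_eq:
  assumes "openin (top_of_set G) V" "z \<in> V" "smooth_on G V f"
  shows "laplace_beltrami G f z = (\<Sum>E\<in>frame. lie_deriv G E (lie_deriv G E f) z)"
  by (simp add: laplace_beltrami_def divergence_gradient_eq[OF assms bounded_linear_Re]
      divergence_gradient_eq[OF assms bounded_linear_Im] complex_eq_iff)

end

section \<open>Regular functions\<close>

text \<open>Rational functions of the matrix entries without poles on \<open>V\<close>, generated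
  inductively so that closure under left-invariant derivatives, and with it smoothness, is proved by
  rule induction.\<close>

inductive regular_on :: "cmat2 set \<Rightarrow> (cmat2 \<Rightarrow> complex) \<Rightarrow> bool" for V where
  const: "regular_on V (\<lambda>_. c)"
| entry: "regular_on V (\<lambda>z. z $ i $ j)"
| add: "regular_on V F \<Longrightarrow> regular_on V H \<Longrightarrow> regular_on V (\<lambda>z. F z + H z)"
| mult: "regular_on V F \<Longrightarrow> regular_on V H \<Longrightarrow> regular_on V (\<lambda>z. F z * H z)"
| inverse: "regular_on V F \<Longrightarrow> (\<And>z. z \<in> V \<Longrightarrow> F z \<noteq> 0) \<Longrightarrow> regular_on V (\<lambda>z. inverse (F z))"

lemma regular_on_diff: "regular_on V F \<Longrightarrow> regular_on V H \<Longrightarrow> regular_on V (\<lambda>z. F z - H z)"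
  using regular_on.add[OF _ regular_on.mult[OF regular_on.const[of V "-1"]], of F H] by simp

lemma regular_on_minus: "regular_on V F \<Longrightarrow> regular_on V (\<lambda>z. - F z)"
  using regular_on_diff[OF regular_on.const[of V 0]] by simp

lemma regular_on_divide:
  "regular_on V F \<Longrightarrow> regular_on V H \<Longrightarrow> (\<And>z. z \<in> V \<Longrightarrow> H z \<noteq> 0) \<Longrightarrow>
    regular_on V (\<lambda>z. F z / H z)"
  by (simp add: divide_inverse regular_on.mult regular_on.inverse)

lemma regular_on_power: "regular_on V F \<Longrightarrow> regular_on V (\<lambda>z. F z ^ n)"
  by (induction n) (simp_all add: regular_on.const regular_on.mult)

lemmas regular_on_intros = regular_on.const regular_on.entry regular_on.add regular_on.mult
  regular_on_diff regular_on_divide regular_on_power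

lemma matrix_mult_entry: "(z ** X) $ i $ j = z $ i $ 1 * X $ 1 $ j + z $ i $ 2 * X $ 2 $ j"
  for z X :: cmat2
  by (simp add: matrix_matrix_mult_def sum_2)

lemma has_derivative_entry: "((\<lambda>z :: cmat2. z $ i $ j) has_derivative (\<lambda>h. h $ i $ j)) F"
  by (intro bounded_linear_imp_has_derivative bounded_linear_compose[OF bounded_linear_vec_nth]
      bounded_linear_vec_nth)

text \<open>The derivative is taken in the ambient matrix space and so restricts to either group.
  Along \<open>z ** X\<close> it is again regular, because the entries of \<open>z ** X\<close> are
  linear in those of \<open>z\<close>.\<close>

lemma regular_on_derivative:
  assumes "regular_on V F"
  shows "\<exists>F'. (\<forall>z\<in>V. (F has_derivative F' z) (at z)) \<and> (\<forall>X. regular_on V (\<lambda>z. F' z (z ** X)))"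
  using assms
proof induction
  case (const c)
  then show ?case
    by (intro exI[of _ "\<lambda>_ _. 0"]) (simp add: regular_on.const)
next
  case (entry i j)
  then show ?case
    by (intro exI[of _ "\<lambda>_ h. h $ i $ j"])
      (auto simp: has_derivative_entry matrix_mult_entry intro!: regular_on_intros)
next
  case (add F H)
  then obtain F' H' where "\<forall>z\<in>V. (F has_derivative F' z) (at z)" "\<forall>X. regular_on V (\<lambda>z. F' z (z ** X))"
    "\<forall>z\<in>V. (H has_derivative H' z) (at z)" "\<forall>X. regular_on V (\<lambda>z. H' z (z ** X))"
    by blast
  then show ?case
    by (intro exI[of _ "\<lambda>z h. F' z h + H' z h"])
      (auto intro!: regular_on_intros has_derivative_add)
next
  case (mult F H)
  then obtain F' H' where "\<forall>z\<in>V. (F has_derivative F' z) (at z)" "\<forall>X. regular_on V (\<lambda>z. F' z (z ** X))"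
    "\<forall>z\<in>V. (H has_derivative H' z) (at z)" "\<forall>X. regular_on V (\<lambda>z. H' z (z ** X))"
    by blast
  then show ?case
    using mult.hyps
    by (intro exI[of _ "\<lambda>z h. F z * H' z h + F' z h * H z"])
      (auto intro!: regular_on_intros has_derivative_mult)
next
  case (inverse F)
  then obtain F' where "\<forall>z\<in>V. (F has_derivative F' z) (at z)" "\<forall>X. regular_on V (\<lambda>z. F' z (z ** X))"
    by blast
  then show ?case
    using inverse.hyps
    by (intro exI[of _ "\<lambda>z h. - (inverse (F z) * F' z h * inverse (F z))"])
      (simp add: regular_on_minus regular_on.mult regular_on.inverse)
qed

lemma regular_on_differentiable:
  "regular_on V F \<Longrightarrow> z \<in> V \<Longrightarrow> F differentiable (at z within G)"
  using regular_on_derivative[of V F] has_derivative_at_withinI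
  unfolding differentiable_def by blast

context unitary_matrix_group
begin

lemma lie_deriv_regular:
  assumes V: "openin (top_of_set G) V" and "regular_on V F" "X \<in> lie_algebra G"
  obtains H where "regular_on V H" "\<And>z. z \<in> V \<Longrightarrow> lie_deriv G X F z = H z"
proof -
  obtain F' where F': "\<And>z. z \<in> V \<Longrightarrow> (F has_derivative F' z) (at z)"
    "regular_on V (\<lambda>z. F' z (z ** X))"
    using regular_on_derivative[OF assms(2)] by blast
  moreover have "lie_deriv G X F z = F' z (z ** X)" if "z \<in> V" for z
    using lie_deriv_eq[OF _ assms(3) has_derivative_at_withinI[OF F'(1)[OF that]]]
      openin_imp_subset[OF V] that by blast
  ultimately show ?thesis
    using that by blast
qed

lemma foldr_lie_deriv_regular:
  assumes V: "openin (top_of_set G) V" and "regular_on V F" "Xs \<in> lists (lie_algebra G)"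
  shows "\<exists>H. regular_on V H \<and> (\<forall>z\<in>V. foldr (lie_deriv G) Xs F z = H z)"
  using assms(3)
proof (induction Xs)
  case Nil
  then show ?case
    using assms(2) by auto
next
  case (Cons X Xs)
  then obtain H where H: "regular_on V H" "\<And>z. z \<in> V \<Longrightarrow> foldr (lie_deriv G) Xs F z = H z"
    by auto
  obtain K where K: "regular_on V K" "\<And>z. z \<in> V \<Longrightarrow> lie_deriv G X H z = K z"
    using lie_deriv_regular[OF V H(1) Cons.hyps(1)] by blast
  have "foldr (lie_deriv G) (X # Xs) F z = K z" if "z \<in> V" for z
    using lie_deriv_cong[OF V that H(2)] K(2)[OF that] by simp
  then show ?case
    using K(1) by blast
qed

lemma smooth_on_regular:
  assumes V: "openin (top_of_set G) V" and "regular_on V F"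
  shows "smooth_on G V F"
  unfolding smooth_on_def
proof (intro ballI)
  fix Xs z assume "Xs \<in> lists (lie_algebra G)" "z \<in> V"
  then obtain H where "regular_on V H" "\<And>z. z \<in> V \<Longrightarrow> foldr (lie_deriv G) Xs F z = H z"
    using foldr_lie_deriv_regular[OF V \<open>regular_on V F\<close>] by blast
  then show "foldr (lie_deriv G) Xs F differentiable at z within G"
    using differentiable_cong_openin[OF V \<open>z \<in> V\<close>] regular_on_differentiable \<open>z \<in> V\<close> by blast
qed

lemma lie_deriv_add:
  assumes "z \<in> G" "X \<in> lie_algebra G" "F differentiable (at z within G)" "H differentiable (at z within G)"
  shows "lie_deriv G X (\<lambda>w. F w + H w) z = lie_deriv G X F z + lie_deriv G X H z"
proof -
  obtain F' H' where "(F has_derivative F') (at z within G)" "(H has_derivative H') (at z within G)"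
    using assms(3,4) unfolding differentiable_def by blast
  then show ?thesis
    by (simp add: lie_deriv_eq[OF assms(1,2)] lie_deriv_eq[OF assms(1,2) has_derivative_add])
qed

lemma lie_deriv_mult:
  fixes F H :: "cmat2 \<Rightarrow> complex"
  assumes "z \<in> G" "X \<in> lie_algebra G" "F differentiable (at z within G)" "H differentiable (at z within G)"
  shows "lie_deriv G X (\<lambda>w. F w * H w) z = F z * lie_deriv G X H z + lie_deriv G X F z * H z"
proof -
  obtain F' H' where "(F has_derivative F') (at z within G)" "(H has_derivative H') (at z within G)"
    using assms(3,4) unfolding differentiable_def by blast
  then show ?thesis
    by (simp add: lie_deriv_eq[OF assms(1,2)] lie_deriv_eq[OF assms(1,2) has_derivative_mult])
qed

lemma lie_deriv_const: "z \<in> G \<Longrightarrow> X \<in> lie_algebra G \<Longrightarrow> lie_deriv G X (\<lambda>w. c) z = 0"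
  using lie_deriv_eq[OF _ _ has_derivative_const] .

section \<open>Product rules\<close>

text \<open>The pairing \<open>\<kappa>\<close> of gradients. It is bilinear over the complex
  numbers, without conjugation, so \<open>\<kappa>(F, F)\<close> can vanish for a nonconstant
  \<open>F\<close>.\<close>

definition carre_du_champ :: "(cmat2 \<Rightarrow> complex) \<Rightarrow> (cmat2 \<Rightarrow> complex) \<Rightarrow> cmat2 \<Rightarrow> complex" where
  "carre_du_champ F H z = (\<Sum>E\<in>frame. lie_deriv G E F z * lie_deriv G E H z)"

lemma carre_du_champ_commute: "carre_du_champ F H z = carre_du_champ H F z"
  by (simp add: carre_du_champ_def mult.commute)

context
  fixes V
  assumes V: "openin (top_of_set G) V"
begin

lemma in_group: "z \<in> V \<Longrightarrow> z \<in> G"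
  using openin_imp_subset[OF V] by blast

lemma lie_deriv_differentiable:
  assumes "regular_on V F" "X \<in> lie_algebra G" "z \<in> V"
  shows "lie_deriv G X F differentiable (at z within G)"
proof -
  obtain H where "regular_on V H" "\<And>z. z \<in> V \<Longrightarrow> lie_deriv G X F z = H z"
    using lie_deriv_regular[OF V assms(1,2)] by blast
  then show ?thesis
    using differentiable_cong_openin[OF V \<open>z \<in> V\<close>] regular_on_differentiable \<open>z \<in> V\<close> by blast
qed

lemma laplace_beltrami_regular:
  "regular_on V F \<Longrightarrow> z \<in> V \<Longrightarrow>
    laplace_beltrami G F z = (\<Sum>E\<in>frame. lie_deriv G E (lie_deriv G E F) z)"
  by (rule laplace_beltrami_eq[OF V _ smooth_on_regular[OF V]])

lemma laplace_beltrami_add: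
  assumes F: "regular_on V F" and H: "regular_on V H" and z: "z \<in> V"
  shows "laplace_beltrami G (\<lambda>w. F w + H w) z = laplace_beltrami G F z + laplace_beltrami G H z"
proof -
  have "lie_deriv G E (lie_deriv G E (\<lambda>w. F w + H w)) z =
      lie_deriv G E (lie_deriv G E F) z + lie_deriv G E (lie_deriv G E H) z" if "E \<in> frame" for E
  proof -
    note E = frame_in_lie_algebra[OF that]
    have "lie_deriv G E (lie_deriv G E (\<lambda>w. F w + H w)) z =
        lie_deriv G E (\<lambda>w. lie_deriv G E F w + lie_deriv G E H w) z"
      by (intro lie_deriv_cong[OF V z] lie_deriv_add E in_group regular_on_differentiable[OF F]
          regular_on_differentiable[OF H])
    also have "\<dots> = lie_deriv G E (lie_deriv G E F) z + lie_deriv G E (lie_deriv G E H) z"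
      by (intro lie_deriv_add E in_group lie_deriv_differentiable F H z)
    finally show ?thesis .
  qed
  then show ?thesis
    by (simp add: laplace_beltrami_regular[OF _ z] F H regular_on.add sum.distrib)
qed

lemma laplace_beltrami_mult:
  assumes F: "regular_on V F" and H: "regular_on V H" and z: "z \<in> V"
  shows "laplace_beltrami G (\<lambda>w. F w * H w) z =
    F z * laplace_beltrami G H z + 2 * carre_du_champ F H z + laplace_beltrami G F z * H z"
proof -
  have "lie_deriv G E (lie_deriv G E (\<lambda>w. F w * H w)) z =
      F z * lie_deriv G E (lie_deriv G E H) z + 2 * (lie_deriv G E F z * lie_deriv G E H z) +
      lie_deriv G E (lie_deriv G E F) z * H z" if "E \<in> frame" for E
  proof -
    note E = frame_in_lie_algebra[OF that]
    note dF = regular_on_differentiable[OF F] and dH = regular_on_differentiable[OF H]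
      and dEF = lie_deriv_differentiable[OF F E] and dEH = lie_deriv_differentiable[OF H E]
    have "lie_deriv G E (lie_deriv G E (\<lambda>w. F w * H w)) z =
        lie_deriv G E (\<lambda>w. F w * lie_deriv G E H w + lie_deriv G E F w * H w) z"
      by (intro lie_deriv_cong[OF V z] lie_deriv_mult E in_group dF dH)
    also have "\<dots> = lie_deriv G E (\<lambda>w. F w * lie_deriv G E H w) z +
        lie_deriv G E (\<lambda>w. lie_deriv G E F w * H w) z"
      by (intro lie_deriv_add E in_group differentiable_mult dF dH dEF dEH z)
    finally show ?thesis
      by (simp add: lie_deriv_mult[OF in_group[OF z] E] dF[OF z] dH[OF z] dEF[OF z] dEH[OF z])
  qed
  then show ?thesis
    by (simp add: laplace_beltrami_regular[OF _ z] F H regular_on.mult sum.distrib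
        carre_du_champ_def flip: sum_distrib_left sum_distrib_right)
qed

lemma laplace_beltrami_const: "z \<in> V \<Longrightarrow> laplace_beltrami G (\<lambda>_. c) z = 0"
proof -
  assume z: "z \<in> V"
  have "lie_deriv G E (lie_deriv G E (\<lambda>_. c)) z = 0" if "E \<in> frame" for E
    using lie_deriv_cong[OF V z, of "lie_deriv G E (\<lambda>_. c)" "\<lambda>_. 0" E]
      lie_deriv_const[OF _ frame_in_lie_algebra[OF that]] in_group z by metis
  then show ?thesis
    by (simp add: laplace_beltrami_regular[OF regular_on.const z])
qed

lemma carre_du_champ_const: "z \<in> V \<Longrightarrow> carre_du_champ (\<lambda>_. c) H z = 0"
  by (simp add: carre_du_champ_def lie_deriv_const in_group frame_in_lie_algebra)

lemma laplace_beltrami_cmult: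
  "regular_on V F \<Longrightarrow> z \<in> V \<Longrightarrow>
    laplace_beltrami G (\<lambda>w. c * F w) z = c * laplace_beltrami G F z"
  by (simp add: laplace_beltrami_mult regular_on.const laplace_beltrami_const carre_du_champ_const)

lemma carre_du_champ_mult:
  assumes "regular_on V F" "regular_on V H" "z \<in> V"
  shows "carre_du_champ (\<lambda>w. F w * H w) K z =
    F z * carre_du_champ H K z + carre_du_champ F K z * H z"
  using assms
  by (simp add: carre_du_champ_def lie_deriv_mult in_group frame_in_lie_algebra
      regular_on_differentiable sum_distrib_left sum_distrib_right sum.distrib algebra_simps
      cong: sum.cong)

lemma carre_du_champ_power:
  assumes "regular_on V F" "z \<in> V"
  shows "carre_du_champ (\<lambda>w. F w ^ n) K z = of_nat n * F z ^ (n - 1) * carre_du_champ F K z"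
proof (induction n)
  case 0
  then show ?case
    using assms by (simp add: carre_du_champ_const)
next
  case (Suc n)
  have "carre_du_champ (\<lambda>w. F w ^ Suc n) K z =
      F z * (of_nat n * F z ^ (n - 1) * carre_du_champ F K z) + carre_du_champ F K z * F z ^ n"
    using assms Suc by (simp add: carre_du_champ_mult regular_on_power)
  also have "\<dots> = of_nat (Suc n) * F z ^ (Suc n - 1) * carre_du_champ F K z"
    \<comment> \<open>At \<open>n = 0\<close> the exponent \<open>n - 1\<close> is truncated to 0,
      but the factor \<open>of_nat n\<close> removes that term.\<close>
    by (cases n) (simp_all add: algebra_simps)
  finally show ?case .
qed

text \<open>In the product rule for \<open>F * F ^ n\<close> the cross term is a multiple of
  \<open>\<kappa>(F, F) = 0\<close>; this is the composition property of harmonic morphisms.\<close>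

lemma laplace_beltrami_power_eq_0:
  assumes "regular_on V F" "z \<in> V" "laplace_beltrami G F z = 0" "carre_du_champ F F z = 0"
  shows "laplace_beltrami G (\<lambda>w. F w ^ n) z = 0"
proof (induction n)
  case 0
  then show ?case
    using assms by (simp add: laplace_beltrami_const)
next
  case (Suc n)
  then show ?case
    using assms by (simp add: laplace_beltrami_mult regular_on_power carre_du_champ_power
        carre_du_champ_commute[of F "\<lambda>w. F w ^ n"])
qed

end

section \<open>The Casimir element\<close>

text \<open>
  The entries involved are \<open>E\<^sub>1\<^sub>2 = x + \<i> y\<close>, \<open>E\<^sub>2\<^sub>1 = - x + \<i> y\<close> and \<open>E\<^sub>1\<^sub>1 - E\<^sub>2\<^sub>2 = \<i> w\<close>, where
  \<open>x, y, w\<close> are inner products of \<open>E\<close> with orthogonal elements of \<open>su(2)\<close>, so that Parseval's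
  identity evaluates the sum for an unknown orthonormal basis.
\<close>

lemma frame_quadratic_sum_12:
  fixes c1 c2 c3 c4 c5 c6 :: complex
  shows "(\<Sum>E\<in>frame. c1 * (E$1$1 - E$2$2)^2 + c2 * ((E$1$1 - E$2$2) * E$1$2) +
      c3 * ((E$1$1 - E$2$2) * E$2$1) + c4 * (E$1$2)^2 + c5 * (E$1$2 * E$2$1) + c6 * (E$2$1)^2) =
    - 2 * c1 - c5"
proof -
  \<comment> \<open>The factors 1/2 make the inner products with a skew-Hermitian \<open>E\<close>
    equal to the real and the imaginary part of \<open>E$1$2\<close>, each of which occurs twice in
    \<open>E\<close>.\<close>
  define L1 L2 L3 :: cmat2 where
    "L1 = vector [vector [0, 1/2], vector [-1/2, 0]]"
    and "L2 = vector [vector [0, \<i>/2], vector [\<i>/2, 0]]"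
    and "L3 = vector [vector [\<i>, 0], vector [0, -\<i>]]"
  have L: "L1 \<in> lie_algebra G" "L2 \<in> lie_algebra G" "L3 \<in> lie_algebra G"
    by (rule traceless_in_lie_algebra; simp add: L1_def L2_def L3_def conj_transpose_def
        vec_eq_iff forall_2 trace_def sum_2)+
  have inner: "L1 \<bullet> L1 = 1/2" "L2 \<bullet> L2 = 1/2" "L3 \<bullet> L3 = 2" "L1 \<bullet> L2 = 0" "L1 \<bullet> L3 = 0" "L2 \<bullet> L3 = 0"
    by (simp_all add: L1_def L2_def L3_def inner_vec_def sum_2 inner_complex_def)
  let ?x = "\<lambda>E. L1 \<bullet> E" and ?y = "\<lambda>E. L2 \<bullet> E" and ?w = "\<lambda>E. L3 \<bullet> E"
  have sums: "(\<Sum>E\<in>frame. ?x E * ?x E) = 1/2" "(\<Sum>E\<in>frame. ?y E * ?y E) = 1/2"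
    "(\<Sum>E\<in>frame. ?w E * ?w E) = 2" "(\<Sum>E\<in>frame. ?x E * ?y E) = 0"
    "(\<Sum>E\<in>frame. ?x E * ?w E) = 0" "(\<Sum>E\<in>frame. ?y E * ?w E) = 0"
    using frame_parseval L by (simp_all add: inner)
  have "c1 * (E$1$1 - E$2$2)^2 + c2 * ((E$1$1 - E$2$2) * E$1$2) +
      c3 * ((E$1$1 - E$2$2) * E$2$1) + c4 * (E$1$2)^2 + c5 * (E$1$2 * E$2$1) + c6 * (E$2$1)^2 =
      (c4 + c6 - c5) * of_real (?x E * ?x E) - (c4 + c6 + c5) * of_real (?y E * ?y E) -
      c1 * of_real (?w E * ?w E) + 2 * \<i> * (c4 - c6) * of_real (?x E * ?y E) +
      \<i> * (c2 - c3) * of_real (?x E * ?w E) - (c2 + c3) * of_real (?y E * ?w E)"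
    if "E \<in> frame" for E
  proof -
    have "conj_transpose E = - E"
      using skew_hermitian frame_in_lie_algebra that by blast
    then have skew: "E $ i $ j + cnj (E $ j $ i) = 0" for i j
      by (simp add: skew_hermitian_entries)
    have "Re (E$2$1) = - Re (E$1$2)" "Im (E$2$1) = Im (E$1$2)" "Re (E$1$1) = 0" "Re (E$2$2) = 0"
      using skew[of 1 2] skew[of 1 1] skew[of 2 2] by (auto simp: complex_eq_iff)
    then have e: "E$1$2 = ?x E + \<i> * ?y E" "E$2$1 = - ?x E + \<i> * ?y E" "E$1$1 - E$2$2 = \<i> * ?w E"
      by (simp_all add: L1_def L2_def L3_def inner_vec_def sum_2 inner_complex_def complex_eq_iff)
    have i: "\<i> * \<i> = -1"
      by simp
    show ?thesis
      unfolding e of_real_mult of_real_minus using i by algebra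
  qed
  then have "(\<Sum>E\<in>frame. c1 * (E$1$1 - E$2$2)^2 + c2 * ((E$1$1 - E$2$2) * E$1$2) +
      c3 * ((E$1$1 - E$2$2) * E$2$1) + c4 * (E$1$2)^2 + c5 * (E$1$2 * E$2$1) + c6 * (E$2$1)^2) =
      (\<Sum>E\<in>frame. (c4 + c6 - c5) * of_real (?x E * ?x E) - (c4 + c6 + c5) * of_real (?y E * ?y E) -
      c1 * of_real (?w E * ?w E) + 2 * \<i> * (c4 - c6) * of_real (?x E * ?y E) +
      \<i> * (c2 - c3) * of_real (?x E * ?w E) - (c2 + c3) * of_real (?y E * ?w E))"
    by (rule sum.cong[OF refl])
  \<comment> \<open>Orthogonality removes the mixed terms. As \<open>L1\<close> and
    \<open>L2\<close> have equal norms, \<open>c4\<close> and \<open>c6\<close> then cancel.\<close>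
  also have "\<dots> = (c4 + c6 - c5) * of_real (1/2) - (c4 + c6 + c5) * of_real (1/2) - c1 * of_real 2"
    by (simp only: sum.distrib sum_subtractf sums of_real_0 mult_zero_right add_0_right diff_zero
        flip: sum_distrib_left of_real_sum)
  also have "\<dots> = - 2 * c1 - c5"
    by (simp add: field_simps)
  finally show ?thesis .
qed

lemma frame_quadratic_sum:
  fixes c1 c2 c3 c4 c5 c6 :: complex and i j :: 2
  assumes "i \<noteq> j"
  shows "(\<Sum>E\<in>frame. c1 * (E$i$i - E$j$j)^2 + c2 * ((E$i$i - E$j$j) * E$i$j) +
      c3 * ((E$i$i - E$j$j) * E$j$i) + c4 * (E$i$j)^2 + c5 * (E$i$j * E$j$i) + c6 * (E$j$i)^2) =
    - 2 * c1 - c5"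
proof (cases "i = 1")
  case True
  then have "j = 2"
    using assms exhaust_2[of j] by auto
  then show ?thesis
    using True frame_quadratic_sum_12 by simp
next
  case False
  then have "i = 2" "j = 1"
    using assms exhaust_2[of i] exhaust_2[of j] by auto
  then show ?thesis
    \<comment> \<open>Exchanging the indices changes the sign of the diagonal difference and swaps
      the off-diagonal entries: \<open>c2\<close> and \<open>c3\<close> trade places with a sign,
      \<open>c4\<close> and \<open>c6\<close> without.\<close>
    using frame_quadratic_sum_12[of c1 "- c3" "- c2" c6 c5 c4] by (simp add: algebra_simps power2_eq_square)
qed

end

section \<open>Affine coordinates\<close>

definition row_comb :: "complex \<Rightarrow> 2 \<Rightarrow> cmat2 \<Rightarrow> complex" where
  "row_comb t i z = t * z $ 1 $ i + z $ 2 $ i"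

definition coord_a :: "complex \<Rightarrow> 2 \<Rightarrow> 2 \<Rightarrow> cmat2 \<Rightarrow> complex" where
  "coord_a t i j z = row_comb t j z / row_comb t i z"

definition coord_b :: "complex \<Rightarrow> 2 \<Rightarrow> cmat2 \<Rightarrow> complex" where
  "coord_b t i z = z $ 1 $ i / row_comb t i z"

text \<open>The derivative of \<open>coord_a\<close> with respect to \<open>t\<close>. The terms of
  the numerator containing \<open>t\<close> cancel and leave the determinant up to sign.\<close>

definition coord_d :: "complex \<Rightarrow> 2 \<Rightarrow> 2 \<Rightarrow> cmat2 \<Rightarrow> complex" where
  "coord_d t i j z =
    (z $ 1 $ j * row_comb t i z - z $ 1 $ i * row_comb t j z) / (row_comb t i z)^2"

text \<open>The exponent \<open>m\<close> is written \<open>Suc n\<close>, so that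
  \<open>m - 1\<close> needs no truncated subtraction.\<close>

definition biharmonic_form ::
    "complex \<Rightarrow> 2 \<Rightarrow> 2 \<Rightarrow> nat \<Rightarrow> complex \<Rightarrow> complex \<Rightarrow> complex \<Rightarrow> cmat2 \<Rightarrow> complex" where
  "biharmonic_form t i j n A B C z =
    A * coord_a t i j z ^ Suc n + B * (coord_b t i z * coord_a t i j z ^ Suc n) +
    C * (coord_a t i j z ^ n * coord_d t i j z)"

lemma matrix_mult_entry_neq:
  fixes z X :: cmat2
  assumes "i \<noteq> j"
  shows "(z ** X) $ k $ i = z $ k $ i * X $ i $ i + z $ k $ j * X $ j $ i"
  using assms exhaust_2[of i] exhaust_2[of j] by (auto simp: matrix_mult_entry)

lemma row_comb_mult:
  assumes "i \<noteq> j"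
  shows "row_comb t i (z ** X) = row_comb t i z * X $ i $ i + row_comb t j z * X $ j $ i"
  by (simp add: row_comb_def matrix_mult_entry_neq[OF assms] algebra_simps)

lemma has_derivative_row_comb: "(row_comb t i has_derivative row_comb t i) F"
  unfolding row_comb_def
  by (intro has_derivative_add has_derivative_mult_right has_derivative_entry)

lemma regular_on_row_comb: "regular_on V (row_comb t i)"
  unfolding row_comb_def by (intro regular_on_intros)

lemma regular_on_coords:
  assumes "\<And>z. z \<in> V \<Longrightarrow> row_comb t i z \<noteq> 0"
  shows "regular_on V (coord_a t i j)" "regular_on V (coord_b t i)" "regular_on V (coord_d t i j)"
  unfolding coord_a_def coord_b_def coord_d_def
  by (intro regular_on_intros regular_on_row_comb; simp add: assms)+

lemma regular_on_biharmonic_form: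
  assumes "\<And>z. z \<in> V \<Longrightarrow> row_comb t i z \<noteq> 0"
  shows "regular_on V (biharmonic_form t i j n A B C)"
  unfolding biharmonic_form_def
  by (intro regular_on_intros regular_on_coords assms)

section \<open>Derivatives, gradient pairings and Laplacians of the affine coordinates\<close>

context unitary_matrix_group
begin

context
  fixes V t i j
  assumes V: "openin (top_of_set G) V" and nz: "\<And>z. z \<in> V \<Longrightarrow> row_comb t i z \<noteq> 0"
    and ij: "i \<noteq> j"
begin

lemmas ji = ij[symmetric]
lemma regs: "regular_on V (coord_a t i j)" "regular_on V (coord_b t i)" "regular_on V (coord_d t i j)"
  by (rule regular_on_coords; simp add: nz)+

text \<open>The field \<open>X\<close> acts on the row \<open>(u, v)\<close> by right
  multiplication, and \<open>a = v/u\<close> is an affine coordinate of the projective line, whence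
  a quadratic polynomial in \<open>a\<close>. Only the difference of the diagonal entries occurs,
  which reflects the circle invariance.\<close>

lemma lie_deriv_coord_a:
  assumes "z \<in> V" "X \<in> lie_algebra G"
  shows "lie_deriv G X (coord_a t i j) z =
    X$i$j - coord_a t i j z * (X$i$i - X$j$j) - (coord_a t i j z)^2 * X$j$i"
proof -
  have D: "(coord_a t i j has_derivative (\<lambda>h. (row_comb t j h * row_comb t i z -
      row_comb t j z * row_comb t i h) / (row_comb t i z * row_comb t i z))) (at z within G)"
    unfolding coord_a_def
    by (intro has_derivative_divide' has_derivative_row_comb nz assms)
  show ?thesis
    unfolding lie_deriv_eq[OF in_group[OF V assms(1)] assms(2) D] using nz[OF assms(1)]
    by (simp add: row_comb_mult[OF ij] row_comb_mult[OF ji] coord_a_def divide_simps power2_eq_square) algebra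
qed

lemma lie_deriv_coord_b:
  assumes "z \<in> V" "X \<in> lie_algebra G"
  shows "lie_deriv G X (coord_b t i) z = coord_d t i j z * X$j$i"
proof -
  have D: "(coord_b t i has_derivative (\<lambda>h. (h $ 1 $ i * row_comb t i z -
      z $ 1 $ i * row_comb t i h) / (row_comb t i z * row_comb t i z))) (at z within G)"
    unfolding coord_b_def
    by (intro has_derivative_divide' has_derivative_row_comb has_derivative_entry nz assms)
  show ?thesis
    unfolding lie_deriv_eq[OF in_group[OF V assms(1)] assms(2) D] using nz[OF assms(1)]
    by (simp add: row_comb_mult[OF ij] matrix_mult_entry_neq[OF ij] coord_d_def divide_simps
        power2_eq_square) algebra
qed

lemma lie_deriv_coord_d:
  assumes "z \<in> V" "X \<in> lie_algebra G"
  shows "lie_deriv G X (coord_d t i j) z =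
    - coord_d t i j z * (X$i$i - X$j$j + 2 * coord_a t i j z * X$j$i)"
proof -
  let ?u = "row_comb t i" and ?v = "row_comb t j"
  have D: "(coord_d t i j has_derivative (\<lambda>h.
      ((z $ 1 $ j * ?u h + h $ 1 $ j * ?u z - (z $ 1 $ i * ?v h + h $ 1 $ i * ?v z)) * (?u z)^2 -
       (z $ 1 $ j * ?u z - z $ 1 $ i * ?v z) * (of_nat 2 * ?u h * ?u z ^ (2 - 1))) /
      ((?u z)^2 * (?u z)^2))) (at z within G)"
    unfolding coord_d_def
    by (intro has_derivative_divide' has_derivative_diff has_derivative_mult has_derivative_power
        has_derivative_row_comb has_derivative_entry) (simp add: nz assms)
  show ?thesis
    unfolding lie_deriv_eq[OF in_group[OF V assms(1)] assms(2) D] using nz[OF assms(1)]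
    by (simp add: row_comb_mult[OF ij] row_comb_mult[OF ji] matrix_mult_entry_neq[OF ij]
        matrix_mult_entry_neq[OF ji] coord_d_def coord_a_def divide_simps power2_eq_square) algebra
qed

text \<open>Products of the first derivatives are quadratic in the entries of \<open>E\<close>. The
  arguments given to \<open>sum\<close> are their six coefficients, and the value is
  \<open>- 2 * c1 - c5\<close>.\<close>

lemma carre_du_champ_coords:
  assumes z: "z \<in> V"
  shows "carre_du_champ (coord_a t i j) (coord_a t i j) z = 0"
    and "carre_du_champ (coord_a t i j) (coord_b t i) z = - coord_d t i j z"
    and "carre_du_champ (coord_a t i j) (coord_d t i j) z = 0"
proof -
  let ?a = "coord_a t i j z" and ?d = "coord_d t i j z"
  note sum = frame_quadratic_sum[OF ij]
  note ld = lie_deriv_coord_a[OF z frame_in_lie_algebra] lie_deriv_coord_b[OF z frame_in_lie_algebra]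
    lie_deriv_coord_d[OF z frame_in_lie_algebra]
  have "carre_du_champ (coord_a t i j) (coord_a t i j) z = - 2 * ?a^2 - (- 2 * ?a^2)"
    unfolding carre_du_champ_def sum[of "?a^2" "- 2 * ?a" "2 * ?a^3" 1 "- 2 * ?a^2" "?a^4", symmetric]
    by (intro sum.cong refl) (simp add: ld, algebra)
  then show "carre_du_champ (coord_a t i j) (coord_a t i j) z = 0"
    by simp
  have "carre_du_champ (coord_a t i j) (coord_b t i) z = - 2 * 0 - ?d"
    unfolding carre_du_champ_def sum[of 0 0 "- ?a * ?d" 0 "?d" "- (?a^2 * ?d)", symmetric]
    by (intro sum.cong refl) (simp add: ld, algebra)
  then show "carre_du_champ (coord_a t i j) (coord_b t i) z = - ?d"
    by simp
  have "carre_du_champ (coord_a t i j) (coord_d t i j) z = - 2 * (?a * ?d) - (- 2 * ?a * ?d)"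
    unfolding carre_du_champ_def
      sum[of "?a * ?d" "- ?d" "3 * ?a^2 * ?d" 0 "- 2 * ?a * ?d" "2 * ?a^3 * ?d", symmetric]
    by (intro sum.cong refl) (simp add: ld, algebra)
  then show "carre_du_champ (coord_a t i j) (coord_d t i j) z = 0"
    by simp
qed

lemma laplace_beltrami_coords:
  assumes z: "z \<in> V"
  shows "laplace_beltrami G (coord_a t i j) z = 0"
    and "laplace_beltrami G (coord_b t i) z = 0"
    and "laplace_beltrami G (coord_d t i j) z = 0"
proof -
  let ?a = "coord_a t i j" and ?d = "coord_d t i j"
  note sum = frame_quadratic_sum[OF ij]
  have G: "z \<in> G"
    by (rule in_group[OF V z])
  have D: "(F has_derivative frechet_derivative F (at z within G)) (at z within G)"
    if "regular_on V F" for F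
    using regular_on_differentiable[OF that z] frechet_derivative_works by blast
  have lda: "lie_deriv G E ?a z = E$i$j - ?a z * (E$i$i - E$j$j) - (?a z)^2 * E$j$i"
    and ldd: "lie_deriv G E ?d z = - ?d z * (E$i$i - E$j$j + 2 * ?a z * E$j$i)"
    if "E \<in> frame" for E
    using lie_deriv_coord_a lie_deriv_coord_d z frame_in_lie_algebra[OF that] by blast+
  have a: "lie_deriv G E (lie_deriv G E ?a) z =
      - lie_deriv G E ?a z * (E$i$i - E$j$j + 2 * ?a z * E$j$i)" if "E \<in> frame" for E
  proof -
    note E = frame_in_lie_algebra[OF that]
    have "lie_deriv G E (lie_deriv G E ?a) z =
        lie_deriv G E (\<lambda>w. E$i$j - ?a w * (E$i$i - E$j$j) - (?a w)^2 * E$j$i) z"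
      \<comment> \<open>The first-order formula holds on all of \<open>V\<close>, so it may be
        differentiated once more.\<close>
      by (rule lie_deriv_cong[OF V z]) (rule lie_deriv_coord_a[OF _ E])
    also have "\<dots> = - lie_deriv G E ?a z * (E$i$i - E$j$j + 2 * ?a z * E$j$i)"
      by (subst lie_deriv_eq[OF G E], (rule has_derivative_diff has_derivative_mult_left
        has_derivative_mult_right has_derivative_const has_derivative_power D regs)+)
        (simp add: lie_deriv_def algebra_simps)
    finally show ?thesis .
  qed
  have b: "lie_deriv G E (lie_deriv G E (coord_b t i)) z = lie_deriv G E ?d z * E$j$i"
    if "E \<in> frame" for E
  proof -
    note E = frame_in_lie_algebra[OF that]
    have "lie_deriv G E (lie_deriv G E (coord_b t i)) z = lie_deriv G E (\<lambda>w. ?d w * E$j$i) z"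
      by (rule lie_deriv_cong[OF V z]) (rule lie_deriv_coord_b[OF _ E])
    also have "\<dots> = lie_deriv G E ?d z * E$j$i"
      by (subst lie_deriv_eq[OF G E], (rule derivative_intros D regs)+) (simp add: lie_deriv_def)
    finally show ?thesis .
  qed
  have d: "lie_deriv G E (lie_deriv G E ?d) z =
      - lie_deriv G E ?d z * (E$i$i - E$j$j + 2 * ?a z * E$j$i) -
      2 * ?d z * lie_deriv G E ?a z * E$j$i" if "E \<in> frame" for E
  proof -
    note E = frame_in_lie_algebra[OF that]
    have "lie_deriv G E (lie_deriv G E ?d) z =
        lie_deriv G E (\<lambda>w. - ?d w * (E$i$i - E$j$j + 2 * ?a w * E$j$i)) z"
      by (rule lie_deriv_cong[OF V z]) (rule lie_deriv_coord_d[OF _ E])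
    also have "\<dots> = - lie_deriv G E ?d z * (E$i$i - E$j$j + 2 * ?a z * E$j$i) -
        2 * ?d z * lie_deriv G E ?a z * E$j$i"
      by (subst lie_deriv_eq[OF G E], (rule derivative_intros D regs)+)
        (simp add: lie_deriv_def algebra_simps)
    finally show ?thesis .
  qed
  have "laplace_beltrami G ?a z = - 2 * ?a z - (- 2 * ?a z)"
    unfolding laplace_beltrami_regular[OF V regs(1) z]
      sum[of "?a z" "- 1" "3 * (?a z)^2" 0 "- 2 * ?a z" "2 * (?a z)^3", symmetric]
    by (intro sum.cong refl) (simp add: a lda, algebra)
  then show "laplace_beltrami G ?a z = 0"
    by simp
  have "laplace_beltrami G (coord_b t i) z = - 2 * 0 - 0"
    unfolding laplace_beltrami_regular[OF V regs(2) z]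
      sum[of 0 0 "- ?d z" 0 0 "- 2 * ?a z * ?d z", symmetric]
    by (intro sum.cong refl) (simp add: b ldd, algebra)
  then show "laplace_beltrami G (coord_b t i) z = 0"
    by simp
  have "laplace_beltrami G ?d z = - 2 * ?d z - (- 2 * ?d z)"
    unfolding laplace_beltrami_regular[OF V regs(3) z]
      sum[of "?d z" 0 "6 * ?a z * ?d z" 0 "- 2 * ?d z" "6 * (?a z)^2 * ?d z", symmetric]
    by (intro sum.cong refl) (simp add: d lda ldd, algebra)
  then show "laplace_beltrami G ?d z = 0"
    by simp
qed

text \<open>Only the term with \<open>b\<close> contributes, through
  \<open>\<kappa>(a, b) = - d\<close>. The result has the same shape with \<open>A = B = 0\<close>,
  so a second application of the lemma gives 0.\<close>

lemma laplace_beltrami_biharmonic_form: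
  assumes z: "z \<in> V"
  shows "laplace_beltrami G (biharmonic_form t i j n A B C) z =
    biharmonic_form t i j n 0 0 (- 2 * of_nat (Suc n) * B) z"
proof -
  let ?a = "coord_a t i j" and ?b = "coord_b t i" and ?d = "coord_d t i j"
  note reg = regs regular_on_power[OF regs(1)]
  note \<kappa> = carre_du_champ_coords[OF z] and \<Delta> = laplace_beltrami_coords[OF z]
  have pow: "laplace_beltrami G (\<lambda>w. ?a w ^ m) z = 0" for m
    by (intro laplace_beltrami_power_eq_0[OF V] regs z \<kappa> \<Delta>)
  have "carre_du_champ ?b (\<lambda>w. ?a w ^ Suc n) z = of_nat (Suc n) * ?a z ^ n * (- ?d z)"
    using carre_du_champ_power[OF V regs(1) z, where n = "Suc n" and K = ?b]
    by (simp add: carre_du_champ_commute[of ?b] \<kappa>)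
  then have "laplace_beltrami G (\<lambda>w. ?b w * ?a w ^ Suc n) z = 2 * (of_nat (Suc n) * ?a z ^ n * (- ?d z))"
    by (simp only: laplace_beltrami_mult[OF V regs(2) reg(4) z] pow \<Delta> mult_zero_left
        mult_zero_right add_0_left add_0_right)
  moreover have "laplace_beltrami G (\<lambda>w. ?a w ^ n * ?d w) z = 0"
    using carre_du_champ_power[OF V regs(1) z, where n = n and K = ?d]
    by (simp add: laplace_beltrami_mult[OF V reg(4) regs(3) z] pow \<Delta> \<kappa>)
  moreover have "laplace_beltrami G (biharmonic_form t i j n A B C) z =
      A * laplace_beltrami G (\<lambda>w. ?a w ^ Suc n) z +
      B * laplace_beltrami G (\<lambda>w. ?b w * ?a w ^ Suc n) z +
      C * laplace_beltrami G (\<lambda>w. ?a w ^ n * ?d w) z"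
    unfolding biharmonic_form_def
    by (simp only: laplace_beltrami_add[OF V] laplace_beltrami_cmult[OF V] z reg
        regular_on.const regular_on.add regular_on.mult)
  ultimately show ?thesis
    by (simp only: pow biharmonic_form_def) (simp add: algebra_simps)
qed

lemma proper_biharmonic_on_form:
  assumes f: "\<And>z. z \<in> V \<Longrightarrow> f z = biharmonic_form t i j n A B C z" and "B \<noteq> 0"
    and z0: "z\<^sub>0 \<in> V" "row_comb t j z\<^sub>0 \<noteq> 0" "det z\<^sub>0 \<noteq> 0"
  shows "proper_biharmonic_on G V f"
  unfolding proper_biharmonic_on_def
proof (intro conjI ballI)
  show "openin (top_of_set G) V"
    by (rule V)
  show "smooth_on G V f"
    by (rule smooth_on_cong[OF V f smooth_on_regular[OF V regular_on_biharmonic_form[OF nz]]])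
  have lap: "laplace_beltrami G f z = biharmonic_form t i j n 0 0 (- 2 * of_nat (Suc n) * B) z"
    if "z \<in> V" for z
    using laplace_beltrami_cong[OF V that f] laplace_beltrami_biharmonic_form[OF that] by simp
  show "(laplace_beltrami G ^^ 2) f z = 0" if z: "z \<in> V" for z
  proof -
    have "(laplace_beltrami G ^^ 2) f z = laplace_beltrami G (laplace_beltrami G f) z"
      by (simp add: numeral_2_eq_2)
    also have "\<dots> = laplace_beltrami G (biharmonic_form t i j n 0 0 (- 2 * of_nat (Suc n) * B)) z"
      by (rule laplace_beltrami_cong[OF V z lap])
    also have "\<dots> = 0"
      unfolding laplace_beltrami_biharmonic_form[OF z] by (simp add: biharmonic_form_def)
    finally show ?thesis .
  qed
  \<comment> \<open>The numerator of \<open>d\<close> is the determinant up to sign, so neither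
    \<open>a\<close> nor \<open>d\<close> vanishes at \<open>z\<^sub>0\<close>.\<close>
  have "z\<^sub>0 $ 1 $ j * row_comb t i z\<^sub>0 - z\<^sub>0 $ 1 $ i * row_comb t j z\<^sub>0 \<noteq> 0"
  proof -
    have "i = 1 \<and> j = 2 \<or> i = 2 \<and> j = 1"
      using ij exhaust_2[of i] exhaust_2[of j] by auto
    then show ?thesis
      using z0(3) by (auto simp: det_2 row_comb_def algebra_simps)
  qed
  then have "laplace_beltrami G f z\<^sub>0 \<noteq> 0"
    using z0 nz[OF z0(1)] \<open>B \<noteq> 0\<close>
    by (simp add: lap[OF z0(1)] biharmonic_form_def coord_a_def coord_d_def del: of_nat_Suc)
  then show "\<exists>z\<in>V. laplace_beltrami G f z \<noteq> 0"
    using z0(1) by blast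
qed

end

end

section \<open>Density\<close>

lemma rotation_in_SU2: "unitary_curve 0 0 1 1 \<theta> \<in> SU2"
  by (simp add: SU2_def unitary_curve_in_U2 det_unitary_curve)

lemma row_comb_rotation:
  "row_comb t 1 (z ** unitary_curve 0 0 1 1 \<theta>) = row_comb t 1 z * cos \<theta> - row_comb t 2 z * sin \<theta>"
  "row_comb t 2 (z ** unitary_curve 0 0 1 1 \<theta>) = row_comb t 1 z * sin \<theta> + row_comb t 2 z * cos \<theta>"
  by (simp_all add: row_comb_mult[of 1 2] row_comb_mult[of 2 1] unitary_curve_def)

lemma sin_cos_pos:
  fixes \<theta> :: real
  assumes "0 < \<theta>" "\<theta> < 1"
  shows "sin \<theta> > 0" "cos \<theta> > 0"
  using assms pi_ge_two by (auto intro!: sin_gt_zero cos_gt_zero)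

text \<open>Invertibility prevents \<open>u\<close> and \<open>v\<close> from vanishing together. If
  just one of them vanishes, right multiplication by a small rotation mixes them and makes both
  nonzero.\<close>

lemma dense_nonvanishing_rows:
  "U2 \<subseteq> closure {z \<in> U2. row_comb t 1 z \<noteq> 0 \<and> row_comb t 2 z \<noteq> 0}" (is "_ \<subseteq> closure ?S")
proof
  fix z assume z: "z \<in> U2"
  have "det z \<noteq> 0"
    using z by (simp add: U2_def invertible_det_nz)
  have nz: "row_comb t 1 z \<noteq> 0 \<or> row_comb t 2 z \<noteq> 0"
  proof (rule ccontr)
    assume "\<not> ?thesis"
    then have "z$2$1 = - (t * z$1$1)" "z$2$2 = - (t * z$1$2)"
      by (simp_all add: row_comb_def add_eq_0_iff)
    then show False
      using \<open>det z \<noteq> 0\<close> unfolding det_2 by simp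
  qed
  show "z \<in> closure ?S"
  proof (cases "row_comb t 1 z \<noteq> 0 \<and> row_comb t 2 z \<noteq> 0")
    case True
    then show ?thesis
      using z by (intro subsetD[OF closure_subset]) simp
  next
    case False
    \<comment> \<open>The shift by 2 keeps every angle in the open interval from 0 to 1, where sine
      and cosine are positive.\<close>
    let ?\<theta> = "\<lambda>n. 1 / real (n + 2)"
    let ?w = "\<lambda>n. z ** unitary_curve 0 0 1 1 (?\<theta> n)"
    have curve: "isCont (unitary_curve 0 0 1 1) 0"
      using unitary_curve_derivative by (rule has_vector_derivative_continuous)
    have "bounded_linear (\<lambda>M. z ** M)"
      by (simp add: linear_mult_left linear_linear)
    from bounded_linear.isCont[OF this curve]
    have "isCont (\<lambda>\<theta>. z ** unitary_curve 0 0 1 1 \<theta>) 0" .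
    moreover have "?\<theta> \<longlonglongrightarrow> 0"
      using LIMSEQ_ignore_initial_segment[OF lim_1_over_n, of 2] by simp
    ultimately have "?w \<longlonglongrightarrow> z ** unitary_curve 0 0 1 1 0"
      by (rule isCont_tendsto_compose)
    then have lim: "?w \<longlonglongrightarrow> z"
      by (simp add: unitary_curve_0)
    have "?w n \<in> ?S" for n
    proof -
      have *: "u * c - v * s \<noteq> 0 \<and> u * s + v * c \<noteq> 0"
        if "\<not> (u \<noteq> 0 \<and> v \<noteq> 0)" "u \<noteq> 0 \<or> v \<noteq> 0" "c \<noteq> 0" "s \<noteq> 0" for u v c s :: complex
        using that by auto
      have "0 < sin (?\<theta> n)" "0 < cos (?\<theta> n)"
        by (rule sin_cos_pos; simp)+
      then have "complex_of_real (cos (?\<theta> n)) \<noteq> 0" "complex_of_real (sin (?\<theta> n)) \<noteq> 0"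
        by (simp_all only: of_real_eq_0_iff less_irrefl less_imp_neq[symmetric] not_False_eq_True)
      then have "row_comb t 1 (?w n) \<noteq> 0 \<and> row_comb t 2 (?w n) \<noteq> 0"
        unfolding row_comb_rotation by (rule *[OF False nz])
      moreover have "?w n \<in> U2"
        using z rotation_in_SU2[of "?\<theta> n"] by (simp add: U2_mult SU2_def)
      ultimately show ?thesis
        by simp
    qed
    then show ?thesis
      using lim unfolding closure_sequential by (intro exI[of _ ?w]) simp
  qed
qed

text \<open>At the identity \<open>u = t\<close> and \<open>v = 1\<close>. For \<open>t = 0\<close>
  a rotation gives \<open>u = - sin\<close> and \<open>v = cos\<close> of its angle.\<close>

lemma nonvanishing_rows_SU2:
  obtains z where "z \<in> SU2" "row_comb t 1 z \<noteq> 0" "row_comb t 2 z \<noteq> 0"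
proof (cases "t = 0")
  case True
  show ?thesis
  proof
    show "mat 1 ** unitary_curve 0 0 1 1 (1/2) \<in> SU2"
      using rotation_in_SU2 by simp
    show "row_comb t 1 (mat 1 ** unitary_curve 0 0 1 1 (1/2)) \<noteq> 0"
      "row_comb t 2 (mat 1 ** unitary_curve 0 0 1 1 (1/2)) \<noteq> 0"
      unfolding row_comb_rotation using sin_cos_pos[of "1/2"] True
      by (simp_all add: row_comb_def mat_def)
  qed
next
  case False
  show ?thesis
  proof
    show "mat 1 \<in> SU2"
      using rotation_in_SU2[of 0] by (simp add: unitary_curve_0)
    show "row_comb t 1 (mat 1) \<noteq> 0" "row_comb t 2 (mat 1) \<noteq> 0"
      using False by (simp_all add: row_comb_def mat_def)
  qed
qed

section \<open>The rational functions\<close>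

text \<open>The exponent of \<open>v\<close> in the monomial that column \<open>\<beta>\<close> of \<open>pi3\<close> yields for \<open>q = (t\<^sup>3, t\<^sup>2, t, 1)\<close>.\<close>

definition column_degree :: "4 \<Rightarrow> nat" where
  "column_degree \<beta> = (if \<beta> = 1 then 0 else if \<beta> = 2 then 1 else if \<beta> = 3 then 2 else 3)"

lemma column_degree_cases:
  obtains "\<beta> = 1" "column_degree \<beta> = 0" | "\<beta> = 2" "column_degree \<beta> = 1"
    | "\<beta> = 3" "column_degree \<beta> = 2" | "\<beta> = 4" "column_degree \<beta> = 3"
  using exhaust_4[of \<beta>] by (auto simp: column_degree_def)

lemma column_degree_le: "column_degree \<beta> \<le> 3"
  by (simp add: column_degree_def)

lemma column_degree_inj: "column_degree \<alpha> = column_degree \<beta> \<Longrightarrow> \<alpha> = \<beta>"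
  by (cases \<alpha> rule: column_degree_cases; cases \<beta> rule: column_degree_cases) simp_all

lemma vector_4:
  "(vector [a, b, c, d] :: 'a::zero^4) $ 1 = a" "(vector [a, b, c, d] :: 'a::zero^4) $ 2 = b"
  "(vector [a, b, c, d] :: 'a::zero^4) $ 3 = c" "(vector [a, b, c, d] :: 'a::zero^4) $ 4 = d"
  unfolding vector_def by simp_all

text \<open>\<open>pi3\<close> is the third symmetric power: the entries of a column are the
  coefficients of the powers of \<open>t\<close> in the product of three factors \<open>u\<close> or
  \<open>v\<close>.\<close>

lemma pi3_column:
  assumes "q $ 1 = q $ 4 * t^3" "q $ 2 = q $ 4 * t^2" "q $ 3 = q $ 4 * t"
  shows "(\<Sum>k\<in>UNIV. q $ k * pi3 z $ k $ \<beta>) =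
    q $ 4 * row_comb t 1 z ^ (3 - column_degree \<beta>) * row_comb t 2 z ^ column_degree \<beta>"
  by (cases \<beta> rule: column_degree_cases)
    (simp_all add: sum_4 pi3_def Let_def vector_4 assms row_comb_def power2_eq_square
      power3_eq_cube algebra_simps)

text \<open>The part with \<open>s\<close> is the \<open>t\<close>-derivative of the monomial in
  \<open>pi3_column\<close>, as \<open>u\<close> and \<open>v\<close> have the derivatives
  \<open>z$1$1\<close> and \<open>z$1$2\<close>. Where an exponent is truncated, its
  \<open>of_nat\<close> factor is 0.\<close>

lemma pi3_column_tangent:
  assumes "p $ 1 = p $ 4 * t^3 + s * (3 * t^2)" "p $ 2 = p $ 4 * t^2 + s * (2 * t)"
    "p $ 3 = p $ 4 * t + s" and d: "d = column_degree \<alpha>"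
  shows "(\<Sum>j\<in>UNIV. p $ j * pi3 z $ j $ \<alpha>) =
    p $ 4 * row_comb t 1 z ^ (3 - d) * row_comb t 2 z ^ d +
    s * (of_nat (3 - d) * z$1$1 * row_comb t 1 z ^ (3 - d - 1) * row_comb t 2 z ^ d +
      of_nat d * z$1$2 * row_comb t 1 z ^ (3 - d) * row_comb t 2 z ^ (d - 1))"
  unfolding d
  by (cases \<alpha> rule: column_degree_cases)
    (simp_all add: sum_4 pi3_def Let_def vector_4 assms row_comb_def power2_eq_square
      power3_eq_cube algebra_simps)

text \<open>Numerator and denominator are homogeneous of degree 3 and are divided by
  \<open>u ^ 3\<close>. In the tangent part, \<open>z$1$j = (d + a * b) * u\<close> merges the terms
  with \<open>b\<close> into \<open>(k + l) * b * a ^ l\<close>, which explains the 3.\<close>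

lemma quotient_eq_biharmonic_form:
  fixes p\<^sub>4 q\<^sub>4 s t :: complex and z :: cmat2 and i j :: 2
  defines "u \<equiv> row_comb t i" and "v \<equiv> row_comb t j"
  assumes kl: "k + l = 3" "k' + l' = 3" "l' < l"
    and nz: "q\<^sub>4 * u z ^ k' * v z ^ l' \<noteq> 0"
  shows "(p\<^sub>4 * u z ^ k * v z ^ l + s * (of_nat k * z$1$i * u z ^ (k - 1) * v z ^ l +
      of_nat l * z$1$j * u z ^ k * v z ^ (l - 1))) / (q\<^sub>4 * u z ^ k' * v z ^ l') =
    biharmonic_form t i j (l - l' - 1) (p\<^sub>4 / q\<^sub>4) (3 * s / q\<^sub>4) (of_nat l * s / q\<^sub>4) z"
proof -
  let ?U = "u z" and ?a = "coord_a t i j z" and ?b = "coord_b t i z" and ?d = "coord_d t i j z"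
  have U: "?U \<noteq> 0" and q: "q\<^sub>4 \<noteq> 0"
    using nz kl by auto
  have v: "v z = ?a * ?U" and x: "z$1$i = ?b * ?U"
    using U by (simp_all add: coord_a_def coord_b_def u_def v_def)
  have y: "z$1$j = (?d + ?a * ?b) * ?U"
    using U unfolding coord_a_def coord_b_def coord_d_def u_def[symmetric] v_def[symmetric]
    by (simp add: divide_simps power2_eq_square)
  have P: "p\<^sub>4 * ?U ^ k * v z ^ l + s * (of_nat k * z$1$i * ?U ^ (k - 1) * v z ^ l +
      of_nat l * z$1$j * ?U ^ k * v z ^ (l - 1)) =
      ?U ^ 3 * (p\<^sub>4 * ?a ^ l + s * (3 * ?b * ?a ^ l + of_nat l * ?d * ?a ^ (l - 1)))"
  proof -
    consider "k = 2" "l = 1" | "k = 1" "l = 2" | "k = 0" "l = 3"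
      using kl by linarith
    then show ?thesis
      unfolding v x y by cases (simp_all add: power2_eq_square power3_eq_cube algebra_simps)
  qed
  have Q: "q\<^sub>4 * ?U ^ k' * v z ^ l' = ?U ^ 3 * (q\<^sub>4 * ?a ^ l')"
    unfolding v power_mult_distrib kl(2)[symmetric] power_add by simp
  \<comment> \<open>Only this power is known to be nonzero: for \<open>l' = 0\<close> the coordinate
    \<open>a\<close> itself may vanish.\<close>
  have a: "?a ^ l' \<noteq> 0"
    using nz unfolding Q by simp
  have l: "?a ^ l = ?a ^ l' * ?a ^ Suc (l - l' - 1)" "?a ^ (l - 1) = ?a ^ l' * ?a ^ (l - l' - 1)"
    using kl(3) by (simp_all flip: power_add power_Suc)
  show ?thesis
    unfolding P Q biharmonic_form_def l using U q a
    by (simp add: divide_simps) (simp add: algebra_simps)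
qed

theorem theorem6p1:
  fixes \<alpha> \<beta> :: 4
    and p q :: "complex^4"
    and P Q f :: "complex^2^2 \<Rightarrow> complex"
    and W :: "(complex^2^2) set"
  assumes P_eq: "P = (\<lambda>z. \<Sum>j\<in>UNIV. p $ j * pi3 z $ j $ \<alpha>)"
    and Q_eq: "Q = (\<lambda>z. \<Sum>k\<in>UNIV. q $ k * pi3 z $ k $ \<beta>)"
    and f_eq: "f = (\<lambda>z. P z / Q z)"
    and W_eq: "W = {z \<in> U2. Q z \<noteq> 0}"
    and "\<alpha> \<noteq> \<beta>"
    and "p $ 3 * q $ 4 - p $ 4 * q $ 3 \<noteq> 0"
    and "p $ 1 * (q $ 4)^3 = (q $ 3)^2 * (3 * p $ 3 * q $ 4 - 2 * p $ 4 * q $ 3)"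
    and "q $ 1 * (q $ 4)^2 = (q $ 3)^3"
    and "p $ 2 * (q $ 4)^2 = q $ 3 * (2 * p $ 3 * q $ 4 - p $ 4 * q $ 3)"
    and "q $ 2 * q $ 4 = (q $ 3)^2"
  shows "openin (top_of_set U2) W \<and> U2 \<subseteq> closure W \<and>
         proper_biharmonic_on U2 W f \<and>
         proper_biharmonic_on SU2 (W \<inter> SU2) f"
proof -
  \<comment> \<open>If \<open>q $ 4 = 0\<close>, the last hypothesis forces
    \<open>q $ 3 = 0\<close>, and the determinant condition fails.\<close>
  have q4: "q $ 4 \<noteq> 0"
    using assms(6,10) by auto
  define t where "t = q $ 3 / q $ 4"
  define s where "s = p $ 3 - t * p $ 4"
  let ?u = "row_comb t 1" and ?v = "row_comb t 2"
  let ?k = "column_degree \<alpha>" and ?l = "column_degree \<beta>"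
  have q3: "q $ 3 = q $ 4 * t"
    using q4 by (simp add: t_def)
  have p3: "p $ 3 = p $ 4 * t + s"
    by (simp add: s_def)
  have q2: "q $ 2 = q $ 4 * t^2"
    using assms(10) q4 unfolding q3 by (simp add: power2_eq_square)
  have "q $ 1 * (q $ 4)^2 = (q $ 4 * t^3) * (q $ 4)^2"
    unfolding assms(8) q3 by algebra
  then have q1: "q $ 1 = q $ 4 * t^3"
    using q4 by simp
  have "p $ 1 * (q $ 4)^3 = (p $ 4 * t^3 + s * (3 * t^2)) * (q $ 4)^3"
    unfolding assms(7) q3 p3 by algebra
  then have p1: "p $ 1 = p $ 4 * t^3 + s * (3 * t^2)"
    using q4 by simp
  have "p $ 2 * (q $ 4)^2 = (p $ 4 * t^2 + s * (2 * t)) * (q $ 4)^2"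
    unfolding assms(9) q3 p3 by algebra
  then have p2: "p $ 2 = p $ 4 * t^2 + s * (2 * t)"
    using q4 by simp
  have s: "s \<noteq> 0"
    using assms(6) q4 unfolding q3 p3 by (auto simp: algebra_simps)
  have Q: "Q z = q $ 4 * ?u z ^ (3 - ?l) * ?v z ^ ?l" for z
    unfolding Q_eq by (rule pi3_column[OF q1 q2 q3])
  have P: "P z = p $ 4 * ?u z ^ (3 - ?k) * ?v z ^ ?k +
      s * (of_nat (3 - ?k) * z$1$1 * ?u z ^ (3 - ?k - 1) * ?v z ^ ?k +
        of_nat ?k * z$1$2 * ?u z ^ (3 - ?k) * ?v z ^ (?k - 1))" for z
    unfolding P_eq by (rule pi3_column_tangent[OF p1 p2 p3 refl])
  have "?k \<noteq> ?l"
    using \<open>\<alpha> \<noteq> \<beta>\<close> column_degree_inj by blast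
  obtain i j n A B C where ij: "i \<noteq> j" and B: "B \<noteq> 0" and i: "\<And>z. z \<in> W \<Longrightarrow> row_comb t i z \<noteq> 0"
    and form: "\<And>z. z \<in> W \<Longrightarrow> f z = biharmonic_form t i j n A B C z"
  proof (cases "?l < ?k")
    case True
    then have kl: "3 - ?k + ?k = 3" "3 - ?l + ?l = 3" "?l < ?k"
      using column_degree_le[of \<alpha>] column_degree_le[of \<beta>] by auto
    show ?thesis
    proof (rule that[of 1 2])
      \<comment> \<open>As \<open>?l < ?k \<le> 3\<close>, the factor \<open>u\<close> occurs in
        \<open>Q\<close> with positive exponent.\<close>
      show "?u z \<noteq> 0" if "z \<in> W" for z
        using that kl column_degree_le[of \<alpha>] by (auto simp: W_eq Q)
      show "f z = biharmonic_form t 1 2 (?k - ?l - 1) (p $ 4 / q $ 4) (3 * s / q $ 4) (of_nat ?k * s / q $ 4) z"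
        if "z \<in> W" for z
        using that quotient_eq_biharmonic_form[OF kl] unfolding W_eq f_eq P Q by blast
    qed (use s q4 in simp_all)
  next
    case False
    \<comment> \<open>With the columns exchanged, \<open>v\<close> is the denominator and the
      degrees are replaced by their complements to 3.\<close>
    then have kl: "?k + (3 - ?k) = 3" "?l + (3 - ?l) = 3" "3 - ?l < 3 - ?k"
      using column_degree_le[of \<alpha>] column_degree_le[of \<beta>] \<open>?k \<noteq> ?l\<close> by auto
    show ?thesis
    proof (rule that[of 2 1])
      show "?v z \<noteq> 0" if "z \<in> W" for z
        using that False \<open>?k \<noteq> ?l\<close> by (auto simp: W_eq Q)
      show "f z = biharmonic_form t 2 1 (3 - ?k - (3 - ?l) - 1) (p $ 4 / q $ 4) (3 * s / q $ 4)
          (of_nat (3 - ?k) * s / q $ 4) z" if "z \<in> W" for z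
        using that quotient_eq_biharmonic_form[OF kl, of "q $ 4" t 2 z 1 "p $ 4" s]
        by (simp add: W_eq f_eq P Q algebra_simps)
    qed (use s q4 in simp_all)
  qed
  have "continuous_on UNIV Q"
    unfolding Q[abs_def] row_comb_def by (intro continuous_intros)
  then have "open {z. Q z \<noteq> 0}"
    by (simp add: open_Collect_neq)
  then have W_open: "openin (top_of_set U2) W" and WS_open: "openin (top_of_set SU2) (W \<inter> SU2)"
    unfolding openin_open by (auto simp: W_eq SU2_def)
  \<comment> \<open>One point of SU(2) with \<open>u\<close> and \<open>v\<close> nonzero shows for
    both groups that the Laplacian of \<open>f\<close> is not identically zero.\<close>
  obtain z where z: "z \<in> SU2" "?u z \<noteq> 0" "?v z \<noteq> 0"
    by (rule nonvanishing_rows_SU2)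
  have zW: "z \<in> W \<inter> SU2"
    using z q4 by (simp add: W_eq Q SU2_def)
  have j: "row_comb t j z \<noteq> 0"
    using z exhaust_2[of j] by auto
  have det: "det z \<noteq> 0"
    using z(1) by (simp add: SU2_def)
  have "{z \<in> U2. ?u z \<noteq> 0 \<and> ?v z \<noteq> 0} \<subseteq> W"
    using q4 by (auto simp: W_eq Q)
  then have "U2 \<subseteq> closure W"
    using dense_nonvanishing_rows closure_mono by blast
  moreover have "proper_biharmonic_on U2 W f"
    using zW by (intro U2.proper_biharmonic_on_form[OF W_open i ij form B _ j det]) auto
  moreover have "proper_biharmonic_on SU2 (W \<inter> SU2) f"
    using zW by (intro SU2.proper_biharmonic_on_form[OF WS_open _ ij form B _ j det] i) auto
  ultimately show ?thesis
    using W_open by blast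
qed

end
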